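(* Let $G$ be a group that contains a free abelian subgroup $A\cong\mathbb Z^n$ and acts geometrically on a proper metric space $X$ that admits a consistent, conical, reversible, $G$-equivariant bicombing $\sigma^X$. Then $\partial_{\sigma^X}X$ contains a homeomorphic copy of the sphere $S^{n-1}$. Moreover, if $A$ is of finite index in $G$, then $\partial_{\sigma^X}X$ is homeomorphic to $S^{n-1}$.
   Context: Proper means closed balls are compact. An action via isometries is geometric if $\{g: gK\cap K\ne\emptyset\}$ is finite for every compact $K$ and $G\backslash X$ is compact. A (geodesic) bicombing on a geodesic metric space $(X,d)$ is a continuous map $\sigma\colon X\times X\times[0,1]\to X$ such that each $\sigma_{xy}:=\sigma(x,y,\cdot)$ is a constant speed geodesic from $x$ to $y$. It is consistent if $\operatorname{im}\sigma_{\sigma_{xy}(s),\sigma_{xy}(t)}=\operatorname{im}\sigma_{xy}|_{[s,t]}$ for all $x,y$ and $0\le s<t\le1$; conical if $d(\sigma_{xy}(t),\sigma_{x'y'}(t))\le(1-t)d(x,x')+t\,d(y,y')$ always; reversible if $\sigma_{xy}(t)=\sigma_{yx}(1-t)$ always; $G$-equivariant if $g\sigma_{xy}=\sigma_{gx,gy}$ for all $g\in G$. Boundary: a $\sigma$-ray is an isometric embedding $\xi\colon[0,\infty)\to X$ with $\operatorname{im}\sigma_{\xi(0)\xi(t)}=\operatorname{im}\xi|_{[0,t]}$ for all $t\ge0$. Two $\sigma$-rays $\xi,\zeta$ are asymptotic if $\sup_{t}d(\xi(t),\zeta(t))<\infty$. $\partial_\sigma X$ is the set of asymptoty classes of $\sigma$-rays;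 for each $o\in X$, each class $\bar x$ has a unique representative $\varrho_{o,\bar x}$ with $\varrho_{o,\bar x}(0)=o$. The topology on $\partial_\sigma X$ has as base the sets $\{\bar y\in\partial_\sigma X: d(\varrho_{o,\bar y}(t),\varrho_{o,\bar x}(t))<\epsilon\}$, $\bar x\in\partial_\sigma X$, $t\ge0$, $\epsilon>0$, for a fixed $o\in X$ (the topology does not depend on $o$). *)

theory Defs
  imports "HOL-Analysis.Analysis" "HOL-Algebra.Algebra"
begin

text \<open>A metric space is a type of class \<^class>\<open>metric_space\<close>; it is therefore nonempty.
  The parameter \<open>t\<close> of a bicombing ranges over the whole type \<^typ>\<open>real\<close>, but only its
  values on \<open>{0..1}\<close> are ever constrained or used.\<close>

definition const_speed_geodesic :: "'a::metric_space \<Rightarrow> 'a \<Rightarrow> (real \<Rightarrow> 'a) \<Rightarrow> bool" where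
  "const_speed_geodesic x y \<gamma> \<longleftrightarrow>
     \<gamma> 0 = x \<and> \<gamma> 1 = y \<and> (\<forall>s\<in>{0..1}. \<forall>t\<in>{0..1}. dist (\<gamma> s) (\<gamma> t) = \<bar>s - t\<bar> * dist x y)"

definition bicombing :: "('a::metric_space \<Rightarrow> 'a \<Rightarrow> real \<Rightarrow> 'a) \<Rightarrow> bool" where
  "bicombing \<sigma> \<longleftrightarrow>
     continuous_on (UNIV \<times> UNIV \<times> {0..1}) (\<lambda>(x, y, t). \<sigma> x y t) \<and>
     (\<forall>x y. const_speed_geodesic x y (\<sigma> x y))"

definition consistent :: "('a::metric_space \<Rightarrow> 'a \<Rightarrow> real \<Rightarrow> 'a) \<Rightarrow> bool" where
  "consistent \<sigma> \<longleftrightarrow>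
     (\<forall>x y s t. 0 \<le> s \<and> s < t \<and> t \<le> 1 \<longrightarrow>
        \<sigma> (\<sigma> x y s) (\<sigma> x y t) ` {0..1} = \<sigma> x y ` {s..t})"

definition conical :: "('a::metric_space \<Rightarrow> 'a \<Rightarrow> real \<Rightarrow> 'a) \<Rightarrow> bool" where
  "conical \<sigma> \<longleftrightarrow>
     (\<forall>x y x' y'. \<forall>t\<in>{0..1}.
        dist (\<sigma> x y t) (\<sigma> x' y' t) \<le> (1 - t) * dist x x' + t * dist y y')"

definition reversible :: "('a::metric_space \<Rightarrow> 'a \<Rightarrow> real \<Rightarrow> 'a) \<Rightarrow> bool" where
  "reversible \<sigma> \<longleftrightarrow> (\<forall>x y. \<forall>t\<in>{0..1}. \<sigma> x y t = \<sigma> y x (1 - t))"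

definition equivariant ::
    "('g, 'm) monoid_scheme \<Rightarrow> ('g \<Rightarrow> 'a \<Rightarrow> 'a) \<Rightarrow> ('a::metric_space \<Rightarrow> 'a \<Rightarrow> real \<Rightarrow> 'a) \<Rightarrow> bool" where
  "equivariant G \<phi> \<sigma> \<longleftrightarrow>
     (\<forall>g\<in>carrier G. \<forall>x y. \<forall>t\<in>{0..1}. \<phi> g (\<sigma> x y t) = \<sigma> (\<phi> g x) (\<phi> g y) t)"

definition orbit_topology ::
    "('g, 'm) monoid_scheme \<Rightarrow> ('g \<Rightarrow> 'a \<Rightarrow> 'a) \<Rightarrow> 'a::topological_space set topology" where
  "orbit_topology G \<phi> =
     topology (\<lambda>U. U \<subseteq> orbits G UNIV \<phi> \<and> open {x. orbit G \<phi> x \<in> U})"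

lemma openin_orbit_topology:
  "openin (orbit_topology G \<phi>) U \<longleftrightarrow> U \<subseteq> orbits G UNIV \<phi> \<and> open {x. orbit G \<phi> x \<in> U}"
proof -
  have "istopology (\<lambda>U. U \<subseteq> orbits G UNIV \<phi> \<and> open {x. orbit G \<phi> x \<in> U})"
    unfolding istopology_def
  proof (intro conjI allI impI)
    fix S T
    assume "S \<subseteq> orbits G UNIV \<phi> \<and> open {x. orbit G \<phi> x \<in> S}"
      and "T \<subseteq> orbits G UNIV \<phi> \<and> open {x. orbit G \<phi> x \<in> T}"
    then show "S \<inter> T \<subseteq> orbits G UNIV \<phi>" "open {x. orbit G \<phi> x \<in> S \<inter> T}"
      by (auto simp: Collect_conj_eq)
  next
    fix \<K>
    assume K: "\<forall>K\<in>\<K>. K \<subseteq> orbits G UNIV \<phi> \<and> open {x. orbit G \<phi> x \<in> K}"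
    then show "\<Union>\<K> \<subseteq> orbits G UNIV \<phi>" by blast
    have "{x. orbit G \<phi> x \<in> \<Union>\<K>} = (\<Union>K\<in>\<K>. {x. orbit G \<phi> x \<in> K})" by blast
    with K show "open {x. orbit G \<phi> x \<in> \<Union>\<K>}" by auto
  qed
  then show ?thesis
    by (simp add: orbit_topology_def)
qed

lemma quotient_map_orbit:
  "quotient_map euclidean (orbit_topology G \<phi>) (orbit G \<phi>)"
proof -
  have "openin (orbit_topology G \<phi>) (orbits G UNIV \<phi>)"
  proof -
    have "{x. orbit G \<phi> x \<in> orbits G UNIV \<phi>} = UNIV"
      by (auto simp: orbits_def)
    then show ?thesis
      by (simp add: openin_orbit_topology)
  qed
  then have "topspace (orbit_topology G \<phi>) = orbits G UNIV \<phi>"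
    by (metis openin_orbit_topology openin_subset openin_topspace subset_antisym)
  then show ?thesis
    by (auto simp: quotient_map_def openin_orbit_topology orbits_def)
qed

definition geometric_action ::
    "('g, 'm) monoid_scheme \<Rightarrow> ('g \<Rightarrow> 'a \<Rightarrow> 'a::metric_space) \<Rightarrow> bool" where
  "geometric_action G \<phi> \<longleftrightarrow>
     group_action G UNIV \<phi> \<and>
     (\<forall>g\<in>carrier G. \<forall>x y. dist (\<phi> g x) (\<phi> g y) = dist x y) \<and>
     (\<forall>K. compact K \<longrightarrow> finite {g \<in> carrier G. \<phi> g ` K \<inter> K \<noteq> {}}) \<and>
     compact_space (orbit_topology G \<phi>)"

text \<open>Rays are functions on \<open>[0,\<infinity>)\<close>, hence extensional; this is what makes the representative
  of a boundary point issuing from a given base point unique.\<close>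

definition sigma_rays :: "('a::metric_space \<Rightarrow> 'a \<Rightarrow> real \<Rightarrow> 'a) \<Rightarrow> (real \<Rightarrow> 'a) set" where
  "sigma_rays \<sigma> =
     {\<xi> \<in> extensional {0..}.
        (\<forall>s\<ge>0. \<forall>t\<ge>0. dist (\<xi> s) (\<xi> t) = \<bar>s - t\<bar>) \<and>
        (\<forall>t\<ge>0. \<sigma> (\<xi> 0) (\<xi> t) ` {0..1} = \<xi> ` {0..t})}"

definition asymptotic ::
    "('a::metric_space \<Rightarrow> 'a \<Rightarrow> real \<Rightarrow> 'a) \<Rightarrow> ((real \<Rightarrow> 'a) \<times> (real \<Rightarrow> 'a)) set" where
  "asymptotic \<sigma> =
     {(\<xi>, \<zeta>) \<in> sigma_rays \<sigma> \<times> sigma_rays \<sigma>. bdd_above ((\<lambda>t. dist (\<xi> t) (\<zeta> t)) ` {0..})}"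

lemma equiv_asymptotic: "equiv (sigma_rays \<sigma>) (asymptotic \<sigma>)"
proof (rule equivI)
  show "asymptotic \<sigma> \<subseteq> sigma_rays \<sigma> \<times> sigma_rays \<sigma>"
    by (auto simp: asymptotic_def)
  show "refl_on (sigma_rays \<sigma>) (asymptotic \<sigma>)"
    by (auto simp: refl_on_def asymptotic_def)
  show "sym (asymptotic \<sigma>)"
    by (auto simp: sym_def asymptotic_def dist_commute)
  show "trans (asymptotic \<sigma>)"
  proof (rule transI)
    fix \<xi> \<zeta> \<eta>
    assume *: "(\<xi>, \<zeta>) \<in> asymptotic \<sigma>" "(\<zeta>, \<eta>) \<in> asymptotic \<sigma>"
    then obtain B C where "\<forall>t\<ge>0. dist (\<xi> t) (\<zeta> t) \<le> B" "\<forall>t\<ge>0. dist (\<zeta> t) (\<eta> t) \<le> C"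
      unfolding asymptotic_def bdd_above_def by auto
    then have "\<forall>t\<ge>0. dist (\<xi> t) (\<eta> t) \<le> B + C"
      by (meson add_mono dist_triangle order_trans)
    then have "bdd_above ((\<lambda>t. dist (\<xi> t) (\<eta> t)) ` {0..})"
      by (intro bdd_aboveI[of _ "B + C"]) auto
    with * show "(\<xi>, \<eta>) \<in> asymptotic \<sigma>"
      by (auto simp: asymptotic_def)
  qed
qed

definition boundary :: "('a::metric_space \<Rightarrow> 'a \<Rightarrow> real \<Rightarrow> 'a) \<Rightarrow> (real \<Rightarrow> 'a) set set" where
  "boundary \<sigma> = sigma_rays \<sigma> // asymptotic \<sigma>"

definition ray_from :: "'a \<Rightarrow> (real \<Rightarrow> 'a) set \<Rightarrow> real \<Rightarrow> 'a" where
  "ray_from p c = (THE \<xi>. \<xi> \<in> c \<and> \<xi> 0 = p)"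

definition boundary_nbhd ::
    "('a::metric_space \<Rightarrow> 'a \<Rightarrow> real \<Rightarrow> 'a) \<Rightarrow> 'a \<Rightarrow> (real \<Rightarrow> 'a) set \<Rightarrow> real \<Rightarrow> real \<Rightarrow> (real \<Rightarrow> 'a) set set" where
  "boundary_nbhd \<sigma> p c t e = {c' \<in> boundary \<sigma>. dist (ray_from p c' t) (ray_from p c t) < e}"

text \<open>For a consistent conical bicombing on a proper space the sets below form a base: distances
  between rays from \<open>p\<close> are convex in \<open>t\<close>, hence nondecreasing.\<close>

definition boundary_topology ::
    "('a::metric_space \<Rightarrow> 'a \<Rightarrow> real \<Rightarrow> 'a) \<Rightarrow> 'a \<Rightarrow> (real \<Rightarrow> 'a) set topology" where
  "boundary_topology \<sigma> p =
     topology_generated_by {boundary_nbhd \<sigma> p c t e | c t e. c \<in> boundary \<sigma> \<and> t \<ge> 0 \<and> e > 0}"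

lemma topspace_boundary_topology: "topspace (boundary_topology \<sigma> p) = boundary \<sigma>"
proof -
  let ?B = "{boundary_nbhd \<sigma> p c t e | c t e. c \<in> boundary \<sigma> \<and> t \<ge> 0 \<and> e > 0}"
  have "\<Union>?B = boundary \<sigma>"
  proof
    show "\<Union>?B \<subseteq> boundary \<sigma>"
      by (auto simp: boundary_nbhd_def)
    show "boundary \<sigma> \<subseteq> \<Union>?B"
    proof
      fix c assume c: "c \<in> boundary \<sigma>"
      have "(0::real) \<le> 0" "(0::real) < 1" by simp_all
      with c have "boundary_nbhd \<sigma> p c 0 1 \<in> ?B" by blast
      moreover from c have "c \<in> boundary_nbhd \<sigma> p c 0 1"
        by (simp add: boundary_nbhd_def)
      ultimately show "c \<in> \<Union>?B" by (rule UnionI)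
    qed
  qed
  then show ?thesis
    by (simp add: boundary_topology_def topology_generated_by_topspace)
qed

text \<open>The unit sphere of \<open>n\<close>-dimensional Euclidean space, i.e. the sphere of dimension \<open>n - 1\<close>,
  which is empty for \<open>n = 0\<close>.\<close>

definition unit_sphere :: "nat \<Rightarrow> (nat \<Rightarrow> real) topology" where
  "unit_sphere n = subtopology (Euclidean_space n) {x. (\<Sum>i<n. x i ^ 2) = 1}"

lemma unit_sphere_Suc: "unit_sphere (Suc n) = nsphere n"
  by (simp add: unit_sphere_def nsphere_def lessThan_Suc_atMost)

lemma topspace_unit_sphere_0: "topspace (unit_sphere 0) = {}"
  by (simp add: unit_sphere_def)

end

theory Submission
  imports Defs
begin

text \<open>
  Write \<open>|a|\<close> for the infimum of \<open>x \<mapsto> d(x, a x)\<close>. For \<open>m\<close> the midpoint of \<open>\<sigma>\<^sub>x\<^sub>,\<^sub>a\<^sub>x\<close>, conicality and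
  reversibility give \<open>d(m, a m) \<le> d(x, a\<^sup>2 x) / 2\<close>, while no element commuting with \<open>a\<close> has its
  displacement increased. Hence \<open>|a\<^sup>2| = 2 |a|\<close>, finitely many commuting displacements can be almost
  minimized at once, and a compactness argument yields a point \<open>y\<close> with \<open>d(y, a y) = |a|\<close> for all
  \<open>a \<in> A\<close>. So \<open>A y\<close> is isometric to \<open>\<int>\<^sup>n\<close> with a metric induced by a norm \<open>N\<close> on \<open>\<real>\<^sup>n\<close>.

  For \<open>N x = 1\<close> let \<open>R x\<close> be the limit of the \<open>\<sigma>\<close>-segments from \<open>p\<close> to \<open>\<lfloor>m x\<rfloor> y\<close>, taken for all \<open>x\<close>
  simultaneously along one nontrivial filter \<open>F\<close> of indices \<open>m \<rightarrow> \<infinity>\<close>, which exists by Tychonoff's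
  theorem. Conicality makes \<open>x \<mapsto> R x t\<close> Lipschitz. Comparing distances to the far away orbit points
  \<open>\<lfloor>\<plusminus>m z\<rfloor> y\<close> gives \<open>d(R x t, R x' t) \<ge> t (2 N z - N (z - x) - N (z + x')) - C\<close> for every \<open>z\<close>, and for
  \<open>x \<noteq> x'\<close> some \<open>z\<close> makes the factor positive; so the rays are not asymptotic and the compact sphere
  embeds. If \<open>A\<close> has finite index, every ray \<open>\<zeta>\<close> stays close to \<open>A y\<close>, and refining \<open>F\<close> so that
  \<open>\<zeta>(m) / m\<close> has a limiting direction \<open>x\<close> shows that \<open>\<zeta>\<close> is asymptotic to \<open>R x\<close>.
\<close>

section \<open>Limits along filters and the unit sphere\<close>

lemma compact_PiE_UNIV:
  fixes K :: "'i \<Rightarrow> 'a::topological_space set"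
  assumes "\<And>z. compact (K z)"
  shows "compact (PiE UNIV K)"
proof -
  have "compactin (product_topology (\<lambda>_. euclidean) UNIV) (PiE UNIV K)"
    using assms by (simp add: compactin_PiE compactin_euclidean_iff)
  then show ?thesis by (simp add: euclidean_product_topology compactin_euclidean_iff)
qed

lemma tendsto_fun_coordinate:
  fixes f :: "'b \<Rightarrow> 'i \<Rightarrow> 'a::topological_space"
  assumes "(f \<longlongrightarrow> l) F"
  shows "((\<lambda>b. f b z) \<longlongrightarrow> l z) F"
  by (rule continuous_on_tendsto_compose[OF continuous_on_product_coordinates[of z] assms])
     auto

text \<open>Tychonoff's theorem yields a cluster point \<open>R\<close> of the image of
  \<open>F0\<close> under \<open>f\<close>, and \<open>F\<close> refines \<open>F0\<close> by the
  condition that \<open>f\<close> be close to \<open>R\<close>. A filter instead of a subsequence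
  allows uncountably many \<open>z\<close> at once.\<close>

lemma pointwise_limit_along_filter:
  fixes f :: "'b \<Rightarrow> 'i \<Rightarrow> 'a::topological_space"
  assumes "F0 \<noteq> bot" and "\<And>z. compact (K z)" and "\<And>b z. f b z \<in> K z"
  obtains F R where "F \<noteq> bot" "F \<le> F0" "\<And>z. ((\<lambda>b. f b z) \<longlongrightarrow> R z) F"
proof -
  have "filtermap f F0 \<noteq> bot" using assms(1) by (simp add: filtermap_bot_iff)
  moreover have "eventually (\<lambda>g. g \<in> PiE UNIV K) (filtermap f F0)"
    using assms(3) by (simp add: eventually_filtermap PiE_def)
  ultimately obtain R where R: "inf (nhds R) (filtermap f F0) \<noteq> bot"
    using compact_PiE_UNIV[of K, OF assms(2)] unfolding compact_filter by blast
  define F where "F = inf F0 (filtercomap f (nhds R))"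
  show thesis
  proof (rule that)
    show "F \<le> F0" by (simp add: F_def)
    have "(f \<longlongrightarrow> R) F"
      unfolding F_def filterlim_def by (metis filtercomap_mono filtermap_le_iff_le_filtercomap inf_le2)
    then show "((\<lambda>b. f b z) \<longlongrightarrow> R z) F" for z by (rule tendsto_fun_coordinate)
    show "F \<noteq> bot"
    proof
      assume "F = bot"
      then have "eventually (\<lambda>_. False) F" by simp
      then obtain P Q where P: "eventually P F0" and Q: "eventually Q (filtercomap f (nhds R))"
        and PQ: "\<And>x. P x \<Longrightarrow> Q x \<Longrightarrow> False"
        unfolding F_def eventually_inf by blast
      from Q obtain Q' where Q': "eventually Q' (nhds R)" "\<And>x. Q' (f x) \<Longrightarrow> Q x"
        unfolding eventually_filtercomap by blast
      have "eventually (\<lambda>g. \<not> Q' g) (filtermap f F0)"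
        unfolding eventually_filtermap using P by eventually_elim (use PQ Q' in blast)
      with Q' have "eventually (\<lambda>_. False) (inf (nhds R) (filtermap f F0))"
        unfolding eventually_inf by blast
      with R show False by (simp add: trivial_limit_def)
    qed
  qed
qed

lemma tendsto_abs_diff_le_zero:
  fixes f :: "'b \<Rightarrow> real"
  assumes "\<And>b. \<bar>f b - l\<bar> \<le> g b" "(g \<longlongrightarrow> 0) F"
  shows "(f \<longlongrightarrow> l) F"
  by (rule LIM_zero_cancel, rule Lim_null_comparison[OF _ assms(2)])
     (use assms(1) in \<open>auto intro: always_eventually\<close>)

text \<open>The type \<open>nat \<Rightarrow> real\<close> carries the product topology, so the
  sphere becomes a plain subset to which \<open>continuous_on\<close> and \<open>compact\<close>
  apply.\<close>

lemma unit_sphere_eq_top_of_set: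
  "unit_sphere n = top_of_set {x. (\<forall>i\<ge>n. x i = 0) \<and> (\<Sum>i<n. x i ^ 2) = 1}"
  unfolding unit_sphere_def Euclidean_space_def euclidean_product_topology subtopology_subtopology
  by (rule arg_cong[of _ _ "subtopology euclidean"]) auto

text \<open>Coordinates are continuous, so the equations cut out a closed subset of the cube of all
  functions with values in \<open>{-1..1}\<close>, which is compact by Tychonoff.\<close>

lemma compact_unit_sphere:
  "compact {x :: nat \<Rightarrow> real. (\<forall>i\<ge>n. x i = 0) \<and> (\<Sum>i<n. x i ^ 2) = 1}"
proof -
  let ?S = "{x :: nat \<Rightarrow> real. (\<forall>i\<ge>n. x i = 0) \<and> (\<Sum>i<n. x i ^ 2) = 1}"
  have coord: "continuous_on UNIV (\<lambda>x :: nat \<Rightarrow> real. x i)" for i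
    by (rule continuous_on_product_coordinates)
  have "closed {x :: nat \<Rightarrow> real. (\<Sum>i<n. x i ^ 2) = 1}"
    by (intro closed_Collect_eq continuous_intros coord)
  moreover have "closed {x :: nat \<Rightarrow> real. \<forall>i\<in>{n..}. x i = 0}"
    unfolding Ball_def by (intro closed_Collect_all closed_Collect_imp closed_Collect_eq continuous_intros coord) auto
  moreover have "?S = {x. \<forall>i\<in>{n..}. x i = 0} \<inter> {x. (\<Sum>i<n. x i ^ 2) = 1}" by auto
  ultimately have cl: "closed ?S" by auto
  have sub: "?S \<subseteq> PiE UNIV (\<lambda>i. {-1..1})"
  proof
    fix x assume x: "x \<in> ?S"
    have "x i \<in> {-1..1}" for i
    proof (cases "i < n")
      case True
      then have "x i ^ 2 \<le> (\<Sum>i<n. x i ^ 2)" by (intro member_le_sum) auto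
      with x show ?thesis by (simp add: abs_square_le_1 abs_le_iff)
    next
      case False
      with x show ?thesis by simp
    qed
    then show "x \<in> PiE UNIV (\<lambda>i. {-1..1})" by (auto simp: PiE_def)
  qed
  have "compact (PiE UNIV (\<lambda>i::nat. {-1..1::real}) \<inter> ?S)"
    by (rule compact_Int_closed[OF compact_PiE_UNIV cl]) simp
  then show ?thesis unfolding Int_absorb1[OF sub] .
qed

section \<open>Norms on integer vectors\<close>

text \<open>Models the displacements of \<int>^n at a minimizing point. Vectors are functions on all
  of \<open>nat\<close>, and \<open>q_cong\<close> says that only the first \<open>n\<close> entries
  count. Homogeneity is derived from \<open>q_double\<close>, and definiteness over the reals from
  \<open>q_finite\<close>.\<close>

locale integer_norm =
  fixes n :: nat and q :: "(nat \<Rightarrow> int) \<Rightarrow> real"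
  assumes q_cong: "(\<And>i. i < n \<Longrightarrow> k i = l i) \<Longrightarrow> q k = q l"
    and q_add: "q (\<lambda>i. k i + l i) \<le> q k + q l"
    and q_minus: "q (\<lambda>i. - k i) = q k"
    and q_double: "q (\<lambda>i. 2 * k i) = 2 * q k"
    and q_finite: "finite {k. (\<forall>i\<ge>n. k i = 0) \<and> q k \<le> C}"
begin

lemma q_zero: "q (\<lambda>i. 0) = 0"
  using q_double[of "\<lambda>i. 0"] by simp

lemma q_nonneg: "0 \<le> q k"
  using q_add[of k "\<lambda>i. - k i"] by (simp add: q_minus q_zero)

lemma q_diff_le: "q k - q l \<le> q (\<lambda>i. k i - l i)"
  using q_add[of "\<lambda>i. k i - l i" l] by simp

lemma q_diff_commute: "q (\<lambda>i. k i - l i) = q (\<lambda>i. l i - k i)"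
  using q_minus[of "\<lambda>i. l i - k i"] by simp

lemma q_abs_diff_le: "\<bar>q k - q l\<bar> \<le> q (\<lambda>i. k i - l i)"
  using q_diff_le[of k l] q_diff_le[of l k] q_diff_commute[of k l] by linarith

lemma q_nat_mult_le: "q (\<lambda>i. int m * k i) \<le> real m * q k"
proof (induction m)
  case 0
  show ?case by (simp add: q_zero)
next
  case (Suc m)
  have "q (\<lambda>i. int (Suc m) * k i) \<le> q (\<lambda>i. int m * k i) + q k"
    using q_add[of "\<lambda>i. int m * k i" k] by (simp add: algebra_simps)
  with Suc show ?case by (simp add: algebra_simps)
qed

lemma q_pow2_mult: "q (\<lambda>i. 2 ^ j * k i) = 2 ^ j * q k"
proof (induction j)
  case (Suc j)
  have "q (\<lambda>i. 2 ^ Suc j * k i) = 2 * q (\<lambda>i. 2 ^ j * k i)"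
    using q_double[of "\<lambda>i. 2 ^ j * k i"] by (simp add: mult.assoc)
  with Suc show ?case by simp
qed simp

text \<open>Subadditivity gives one inequality. For the other, \<open>q\<close> is exactly
  homogeneous for the factor \<open>2 ^ m\<close>, and \<open>2 ^ m * k\<close> splits into
  \<open>m * k\<close> and \<open>(2 ^ m - m) * k\<close>, so a loss at \<open>m * k\<close> could
  not be made up by the second summand.\<close>

lemma q_nat_mult: "q (\<lambda>i. int m * k i) = real m * q k"
proof (rule antisym[OF q_nat_mult_le])
  have m: "m \<le> 2 ^ m" by (simp add: less_imp_le)
  have "q (\<lambda>i. 2 ^ m * k i) = q (\<lambda>i. int m * k i + int (2 ^ m - m) * k i)"
    using m by (simp add: of_nat_diff algebra_simps)
  also have "\<dots> \<le> q (\<lambda>i. int m * k i) + real (2 ^ m - m) * q k"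
    using q_add[of "\<lambda>i. int m * k i" "\<lambda>i. int (2 ^ m - m) * k i"] q_nat_mult_le[of "2 ^ m - m" k]
    by linarith
  finally show "real m * q k \<le> q (\<lambda>i. int m * k i)"
    unfolding q_pow2_mult using m by (simp add: of_nat_diff left_diff_distrib)
qed

lemma q_int_mult: "q (\<lambda>i. c * k i) = \<bar>of_int c\<bar> * q k"
proof (cases "0 \<le> c")
  case True
  then show ?thesis using q_nat_mult[of "nat c" k] by simp
next
  case False
  then show ?thesis
    using q_nat_mult[of "nat (- c)" k] q_minus[of "\<lambda>i. c * k i"] by simp
qed

text \<open>Serves as a Lipschitz constant of \<open>q\<close> for the l1 norm; a sum, unlike a
  maximum, also makes sense for \<open>n = 0\<close>.\<close>

definition lip :: real where
  "lip = (\<Sum>j<n. q (\<lambda>i. of_bool (i = j)))"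

lemma lip_nonneg: "0 \<le> lip"
  by (simp add: lip_def q_nonneg sum_nonneg)

lemma q_le_lip: "q k \<le> lip * (\<Sum>i<n. \<bar>of_int (k i)\<bar>)"
proof -
  let ?e = "\<lambda>j i. of_bool (i = j) :: int"
  \<comment> \<open>Truncations let the induction add one multiple of a basis vector at a
    time.\<close>
  have "q (\<lambda>i. if i < m then k i else 0) \<le> (\<Sum>j<m. \<bar>of_int (k j)\<bar> * q (?e j))" for m
  proof (induction m)
    case (Suc m)
    have "q (\<lambda>i. if i < Suc m then k i else 0)
        = q (\<lambda>i. (if i < m then k i else 0) + k m * ?e m i)"
      by (rule arg_cong[of _ _ q]) (auto simp: fun_eq_iff less_Suc_eq)
    also have "\<dots> \<le> q (\<lambda>i. if i < m then k i else 0) + \<bar>of_int (k m)\<bar> * q (?e m)"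
      by (rule order_trans[OF q_add]) (simp only: q_int_mult order_refl)
    finally show ?case using Suc by simp
  qed (simp add: q_zero)
  then have "q k \<le> (\<Sum>j<n. \<bar>of_int (k j)\<bar> * q (?e j))"
    using q_cong[of k "\<lambda>i. if i < n then k i else 0"] by (metis (mono_tags, lifting))
  also have "\<dots> \<le> (\<Sum>j<n. \<bar>of_int (k j)\<bar> * lip)"
    unfolding lip_def
    by (intro sum_mono mult_left_mono member_le_sum) (auto simp: q_nonneg)
  finally show ?thesis by (simp add: sum_distrib_left mult.commute)
qed

section \<open>Extension of the integer norm to real vectors\<close>

abbreviation l1 :: "(nat \<Rightarrow> real) \<Rightarrow> real" where
  "l1 x \<equiv> \<Sum>i<n. \<bar>x i\<bar>"

definition floor_vec :: "nat \<Rightarrow> (nat \<Rightarrow> real) \<Rightarrow> nat \<Rightarrow> int" where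
  "floor_vec m x i = \<lfloor>real m * x i\<rfloor>"

text \<open>The norm on \<real>^n that extends \<open>q\<close>; \<open>lim\<close> receives its
  meaning from \<open>q_floor_vec_tendsto\<close>.\<close>

definition N :: "(nat \<Rightarrow> real) \<Rightarrow> real" where
  "N x = lim (\<lambda>m. q (floor_vec m x) / real m)"

lemma abs_floor_vec: "\<bar>of_int (floor_vec m x i) - real m * x i\<bar> \<le> 1"
  unfolding floor_vec_def by linarith

text \<open>\<open>m' * floor_vec m x\<close> and \<open>m * floor_vec m' x\<close> both approximate
  \<open>m * m' * x\<close>, with coordinate errors at most \<open>m'\<close> and \<open>m\<close>.
  Division by \<open>m * m'\<close> turns this into a Cauchy estimate.\<close>

lemma q_floor_vec_cross:
  "\<bar>real m' * q (floor_vec m x) - real m * q (floor_vec m' x)\<bar> \<le> lip * n * (real m + real m')"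
proof -
  let ?a = "\<lambda>i. int m' * floor_vec m x i" and ?b = "\<lambda>i. int m * floor_vec m' x i"
  have 1: "\<bar>of_int (?a i - ?b i)\<bar> \<le> real m + real m'" for i
  proof -
    have "real_of_int (?a i - ?b i) = real m' * (of_int (floor_vec m x i) - real m * x i)
        - real m * (of_int (floor_vec m' x i) - real m' * x i)"
      by (simp add: algebra_simps)
    also have "\<bar>\<dots>\<bar> \<le> \<bar>real m' * (of_int (floor_vec m x i) - real m * x i)\<bar>
        + \<bar>real m * (of_int (floor_vec m' x i) - real m' * x i)\<bar>"
      by (rule abs_triangle_ineq4)
    also have "\<dots> \<le> real m' * 1 + real m * 1"
      unfolding abs_mult by (intro add_mono mult_mono abs_floor_vec) auto
    finally show ?thesis by simp
  qed
  have "\<bar>real m' * q (floor_vec m x) - real m * q (floor_vec m' x)\<bar> = \<bar>q ?a - q ?b\<bar>"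
    by (simp add: q_nat_mult)
  also have "\<dots> \<le> lip * (\<Sum>i<n. \<bar>of_int (?a i - ?b i)\<bar>)"
    using q_abs_diff_le q_le_lip order_trans by blast
  also have "\<dots> \<le> lip * (\<Sum>i<n. real m + real m')"
    by (intro mult_left_mono sum_mono 1 lip_nonneg)
  finally show ?thesis by (simp add: algebra_simps)
qed

lemma q_floor_vec_tendsto: "(\<lambda>m. q (floor_vec m x) / real m) \<longlonglongrightarrow> N x"
proof -
  let ?f = "\<lambda>m. q (floor_vec m x) / real m" and ?c = "lip * n"
  have bd: "\<bar>?f m - ?f m'\<bar> \<le> ?c / real m + ?c / real m'" if "0 < m" "0 < m'" for m m'
  proof -
    have "\<bar>?f m - ?f m'\<bar>
        = \<bar>real m' * q (floor_vec m x) - real m * q (floor_vec m' x)\<bar> / (real m * real m')"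
      using that by (simp add: diff_frac_eq abs_divide mult.commute)
    also have "\<dots> \<le> (?c * (real m + real m')) / (real m * real m')"
      by (intro divide_right_mono q_floor_vec_cross) simp
    also have "\<dots> = ?c / real m + ?c / real m'"
      using that by (simp add: field_simps)
    finally show ?thesis .
  qed
  have "Cauchy ?f"
  proof (rule CauchyI')
    fix e :: real assume e: "0 < e"
    obtain M :: nat where M: "2 * ?c / e < M" using reals_Archimedean2 by blast
    show "\<exists>M. \<forall>m\<ge>M. \<forall>m'>m. dist (?f m) (?f m') < e"
    proof (intro exI[of _ "Suc M"] allI impI)
      fix m m' assume m: "Suc M \<le> m" "m < m'"
      have c0: "0 \<le> ?c" by (simp add: lip_nonneg)
      have s: "?c / real j < e / 2" if "M < j" for j
      proof -
        have "2 * ?c / e < real j" using M that by (meson less_trans of_nat_less_iff)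
        then show ?thesis using e that by (simp add: field_simps)
      qed
      have "\<bar>?f m - ?f m'\<bar> \<le> ?c / real m + ?c / real m'" by (rule bd) (use m in auto)
      also have "\<dots> < e / 2 + e / 2" by (intro add_strict_mono s) (use m in auto)
      finally show "dist (?f m) (?f m') < e" by (simp add: dist_real_def)
    qed
  qed
  then show ?thesis
    unfolding N_def using Cauchy_convergent convergent_LIMSEQ_iff by blast
qed

text \<open>An additive error disappears after division by \<open>m\<close>, so inequalities for
  \<open>N\<close> may be checked on rounded vectors up to a constant.\<close>

lemma N_leI:
  assumes "\<And>m. q (floor_vec m x) \<le> real m * b + c"
  shows "N x \<le> b"
proof (rule LIMSEQ_le[OF q_floor_vec_tendsto])
  show "(\<lambda>m. b + c / real m) \<longlonglongrightarrow> b"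
    using tendsto_add[OF tendsto_const[of b] lim_const_over_n[of c]] by simp
  show "\<exists>M. \<forall>m\<ge>M. q (floor_vec m x) / real m \<le> b + c / real m"
    using assms by (intro exI[of _ 1]) (auto simp: field_simps)
qed

text \<open>Divide \<open>q_floor_vec_cross\<close> by \<open>m'\<close> and let \<open>m'\<close>
  tend to infinity. The error is uniform in both \<open>m\<close> and \<open>x\<close>.\<close>

lemma q_floor_vec: "\<bar>q (floor_vec m x) - real m * N x\<bar> \<le> lip * n"
proof -
  have "(\<lambda>m'. \<bar>q (floor_vec m x) - real m * (q (floor_vec m' x) / real m')\<bar>)
      \<longlonglongrightarrow> \<bar>q (floor_vec m x) - real m * N x\<bar>"
    by (intro tendsto_intros q_floor_vec_tendsto)
  moreover have "(\<lambda>m'. lip * n + lip * n * m / real m') \<longlonglongrightarrow> lip * n"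
    using tendsto_add[OF tendsto_const[of "lip * n"] lim_const_over_n[of "lip * n * m"]] by simp
  moreover have "\<bar>q (floor_vec m x) - real m * (q (floor_vec m' x) / real m')\<bar>
      \<le> lip * n + lip * n * m / real m'" if "1 \<le> m'" for m'
  proof -
    have "\<bar>q (floor_vec m x) - real m * (q (floor_vec m' x) / real m')\<bar>
       = \<bar>real m' * q (floor_vec m x) - real m * q (floor_vec m' x)\<bar> / real m'"
    proof -
      have "q (floor_vec m x) - real m * (q (floor_vec m' x) / real m')
          = (real m' * q (floor_vec m x) - real m * q (floor_vec m' x)) / real m'"
        using that by (simp add: field_simps)
      then show ?thesis by (simp only: abs_divide abs_of_nat)
    qed
    also have "\<dots> \<le> (lip * n * (real m + real m')) / real m'"
      by (intro divide_right_mono q_floor_vec_cross) simp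
    also have "\<dots> = lip * n + lip * n * m / real m'"
      using that by (simp add: field_simps)
    finally show ?thesis .
  qed
  ultimately show ?thesis by (blast intro: LIMSEQ_le)
qed

lemma q_diff_le_real:
  "q (\<lambda>i. k i - l i) \<le> lip * (\<Sum>i<n. \<bar>of_int (k i) - of_int (l i)\<bar>)"
  using q_le_lip[of "\<lambda>i. k i - l i"] by simp

lemma N_nonneg: "0 \<le> N x"
  by (rule LIMSEQ_le_const[OF q_floor_vec_tendsto]) (auto simp: q_nonneg)

lemma N_of_int: "N (\<lambda>i. of_int (k i)) = q k"
proof -
  have "q (floor_vec m (\<lambda>i. of_int (k i))) = real m * q k" for m
  proof -
    have "floor_vec m (\<lambda>i. of_int (k i)) = (\<lambda>i. int m * k i)"
      unfolding floor_vec_def by (metis floor_of_int of_int_mult of_int_of_nat_eq)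
    then show ?thesis by (simp add: q_nat_mult)
  qed
  then have "eventually (\<lambda>m. q (floor_vec m (\<lambda>i. of_int (k i))) / real m = q k) sequentially"
    by (intro eventually_sequentiallyI[of 1]) simp
  then show ?thesis
    by (rule LIMSEQ_unique[OF q_floor_vec_tendsto tendsto_eventually])
qed

lemma N_le_lip: "N x \<le> lip * l1 x"
proof (rule N_leI[where c = "lip * n"])
  fix m
  have "q (floor_vec m x) \<le> lip * (\<Sum>i<n. \<bar>of_int (floor_vec m x i)\<bar>)"
    by (rule q_le_lip)
  also have "\<dots> \<le> lip * (\<Sum>i<n. real m * \<bar>x i\<bar> + 1)"
  proof (intro mult_left_mono sum_mono lip_nonneg)
    fix i
    have "\<bar>real m * x i\<bar> = real m * \<bar>x i\<bar>" by (simp add: abs_mult)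
    then show "\<bar>real_of_int (floor_vec m x i)\<bar> \<le> real m * \<bar>x i\<bar> + 1"
      using abs_floor_vec[of m x i] by linarith
  qed
  finally show "q (floor_vec m x) \<le> real m * (lip * l1 x) + lip * n"
    by (simp add: sum.distrib sum_distrib_left algebra_simps)
qed

lemma N_add: "N (\<lambda>i. x i + x' i) \<le> N x + N x'"
\<comment> \<open>Rounding the sum instead of the summands costs 3 per coordinate, and
  \<open>q_floor_vec\<close> costs 1 more for each of \<open>x\<close> and
  \<open>x'\<close>.\<close>
proof (rule N_leI[where c = "5 * (lip * n)"])
  fix m
  let ?s = "\<lambda>i. floor_vec m x i + floor_vec m x' i"
  have "q (floor_vec m (\<lambda>i. x i + x' i)) - q ?s
      \<le> lip * (\<Sum>i<n. \<bar>of_int (floor_vec m (\<lambda>i. x i + x' i) i) - of_int (?s i)\<bar>)"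
    using q_diff_le q_diff_le_real order_trans by blast
  also have "\<dots> \<le> lip * (\<Sum>i<n. 3)"
  proof (intro mult_left_mono sum_mono lip_nonneg)
    fix i
    show "\<bar>real_of_int (floor_vec m (\<lambda>i. x i + x' i) i) - real_of_int (?s i)\<bar> \<le> 3"
      using abs_floor_vec[of m x i] abs_floor_vec[of m x' i] abs_floor_vec[of m "\<lambda>i. x i + x' i" i]
      by (simp add: distrib_left)
  qed
  finally have "q (floor_vec m (\<lambda>i. x i + x' i)) \<le> q ?s + 3 * (lip * n)" by simp
  then show "q (floor_vec m (\<lambda>i. x i + x' i)) \<le> real m * (N x + N x') + 5 * (lip * n)"
    using q_add[of "floor_vec m x" "floor_vec m x'"] q_floor_vec[of m x] q_floor_vec[of m x']
    by (simp add: distrib_left)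
qed

lemma N_minus_le: "N (\<lambda>i. - x i) \<le> N x"
proof (rule N_leI[where c = "3 * (lip * n)"])
  fix m
  have "q (floor_vec m (\<lambda>i. - x i)) - q (\<lambda>i. - floor_vec m x i)
      \<le> lip * (\<Sum>i<n. \<bar>of_int (floor_vec m (\<lambda>i. - x i) i) - of_int (- floor_vec m x i)\<bar>)"
    using q_diff_le q_diff_le_real order_trans by blast
  also have "\<dots> \<le> lip * (\<Sum>i<n. 2)"
  proof (intro mult_left_mono sum_mono lip_nonneg)
    fix i
    show "\<bar>real_of_int (floor_vec m (\<lambda>i. - x i) i) - real_of_int (- floor_vec m x i)\<bar> \<le> 2"
      using abs_floor_vec[of m x i] abs_floor_vec[of m "\<lambda>i. - x i" i] by simp
  qed
  finally have "q (floor_vec m (\<lambda>i. - x i)) \<le> q (floor_vec m x) + 2 * (lip * n)"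
    by (simp add: q_minus)
  then show "q (floor_vec m (\<lambda>i. - x i)) \<le> real m * N x + 3 * (lip * n)"
    using q_floor_vec[of m x] by simp
qed

lemma N_minus: "N (\<lambda>i. - x i) = N x"
  using N_minus_le[of x] N_minus_le[of "\<lambda>i. - x i"] by simp

lemma N_diff_commute: "N (\<lambda>i. x i - x' i) = N (\<lambda>i. x' i - x i)"
  using N_minus[of "\<lambda>i. x i - x' i"] by simp

lemma N_abs_diff_le: "\<bar>N x - N x'\<bar> \<le> N (\<lambda>i. x i - x' i)"
  using N_add[of "\<lambda>i. x i - x' i" x'] N_add[of "\<lambda>i. x' i - x i" x] N_diff_commute[of x x']
  by simp

lemma N_lipschitz: "\<bar>N x - N x'\<bar> \<le> lip * l1 (\<lambda>i. x i - x' i)"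
  using N_abs_diff_le N_le_lip order_trans by blast

text \<open>Rounding \<open>m * c * x\<close> differs boundedly from rounding \<open>r * x\<close>
  with \<open>r\<close> the integer part of \<open>m * c\<close>. Hence \<open>N (c x)\<close> and
  \<open>c * N x\<close> are slopes of the same sequence up to bounded errors, and such slopes
  coincide.\<close>

lemma N_scale:
  assumes "0 \<le> c"
  shows "N (\<lambda>i. c * x i) = c * N x"
proof -
  \<comment> \<open>The summands bound the distance of the two rounded vectors, the error of
    \<open>q_floor_vec\<close> at \<open>r\<close>, and the effect of replacing \<open>m * c\<close>
    by \<open>r\<close>.\<close>
  define b where "b = lip * (\<Sum>i<n. \<bar>x i\<bar> + 2) + lip * n + N x"
  have key: "\<bar>q (floor_vec m (\<lambda>i. c * x i)) - real m * (c * N x)\<bar> \<le> b" for m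
  proof -
    define r where "r = nat \<lfloor>real m * c\<rfloor>"
    have r: "\<bar>real r - real m * c\<bar> \<le> 1"
    proof -
      have "real r = of_int \<lfloor>real m * c\<rfloor>" unfolding r_def using assms by simp
      then show ?thesis by linarith
    qed
    have "\<bar>q (floor_vec m (\<lambda>i. c * x i)) - q (floor_vec r x)\<bar>
        \<le> lip * (\<Sum>i<n. \<bar>of_int (floor_vec m (\<lambda>i. c * x i) i) - of_int (floor_vec r x i)\<bar>)"
      using q_abs_diff_le q_diff_le_real order_trans by blast
    also have "\<dots> \<le> lip * (\<Sum>i<n. \<bar>x i\<bar> + 2)"
    proof (intro mult_left_mono sum_mono lip_nonneg)
      fix i
      have "\<bar>(real r - real m * c) * x i\<bar> \<le> 1 * \<bar>x i\<bar>"
        unfolding abs_mult by (intro mult_right_mono r) auto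
      moreover have "(real r - real m * c) * x i = real r * x i - real m * (c * x i)"
        by (simp add: algebra_simps)
      ultimately show "\<bar>real_of_int (floor_vec m (\<lambda>i. c * x i) i) - of_int (floor_vec r x i)\<bar> \<le> \<bar>x i\<bar> + 2"
        using abs_floor_vec[of m "\<lambda>i. c * x i" i] abs_floor_vec[of r x i] by linarith
    qed
    finally have 1: "\<bar>q (floor_vec m (\<lambda>i. c * x i)) - q (floor_vec r x)\<bar> \<le> lip * (\<Sum>i<n. \<bar>x i\<bar> + 2)" .
    have "\<bar>(real r - real m * c) * N x\<bar> \<le> 1 * N x"
      unfolding abs_mult using mult_right_mono[OF r N_nonneg[of x]] N_nonneg[of x] by simp
    then have "\<bar>real r * N x - real m * (c * N x)\<bar> \<le> N x" by (simp add: algebra_simps)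
    with 1 q_floor_vec[of r x] show ?thesis unfolding b_def by linarith
  qed
  have *: "a = a'" if "\<And>m. \<bar>q (floor_vec m (\<lambda>i. c * x i)) - real m * a\<bar> \<le> d"
    "\<And>m. \<bar>q (floor_vec m (\<lambda>i. c * x i)) - real m * a'\<bar> \<le> d'" for a a' d d' :: real
  proof (rule ccontr)
    assume "a \<noteq> a'"
    then obtain m :: nat where "(d + d') / \<bar>a - a'\<bar> < m" using reals_Archimedean2 by blast
    with \<open>a \<noteq> a'\<close> have "d + d' < real m * \<bar>a - a'\<bar>" by (simp add: field_simps)
    also have "\<dots> = \<bar>real m * a - real m * a'\<bar>"
      by (metis abs_mult abs_of_nat right_diff_distrib)
    also have "\<dots> \<le> d + d'" using that[of m] by linarith
    finally show False by simp
  qed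
  from *[OF q_floor_vec key] show ?thesis .
qed

text \<open>If \<open>N x = 0\<close>, all \<open>floor_vec m x\<close> have bounded
  \<open>q\<close> and so, up to irrelevant entries, lie in a finite set, while their
  \<open>i\<close>-th entries grow like \<open>m * \<bar>x i\<bar>\<close>.\<close>

lemma N_pos:
  assumes "i < n" "x i \<noteq> 0"
  shows "0 < N x"
proof (rule ccontr)
  assume "\<not> 0 < N x"
  then have N0: "N x = 0" using N_nonneg[of x] by simp
  define F where "F = {k. (\<forall>i\<ge>n. k i = 0) \<and> q k \<le> lip * n}"
  have "finite ((\<lambda>k. \<bar>k i\<bar>) ` F)" unfolding F_def by (intro finite_imageI q_finite)
  then obtain B where B: "\<And>k. k \<in> F \<Longrightarrow> \<bar>k i\<bar> \<le> B"
    by (meson bdd_above.E bdd_above_finite imageI)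
  obtain m :: nat where "(of_int B + 1) / \<bar>x i\<bar> < m" using reals_Archimedean2 by blast
  then have m: "of_int B + 1 < real m * \<bar>x i\<bar>" using assms by (simp add: field_simps)
  \<comment> \<open>Members of \<open>F\<close> vanish from index \<open>n\<close> on, which
    \<open>floor_vec m x\<close> may fail to do.\<close>
  define k where "k = (\<lambda>i. if i < n then floor_vec m x i else 0)"
  have "q k = q (floor_vec m x)" by (rule q_cong) (simp add: k_def)
  then have "q k \<le> lip * n" using q_floor_vec[of m x] N0 by simp
  then have "k \<in> F" unfolding F_def k_def by simp
  then have "\<bar>floor_vec m x i\<bar> \<le> B" using B[of k] assms by (simp add: k_def)
  then have "\<bar>of_int (floor_vec m x i)\<bar> \<le> real_of_int B"
    by (metis of_int_abs of_int_le_iff)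
  moreover have "\<bar>real m * x i\<bar> = real m * \<bar>x i\<bar>" by (simp add: abs_mult)
  ultimately show False using m abs_floor_vec[of m x i] by linarith
qed

text \<open>For \<open>u = v\<close> no such \<open>z\<close> exists, by convexity. If none existed for \<open>u \<noteq> v\<close>, then
  \<open>s \<mapsto> N (K (u - v) + s u)\<close> would for large \<open>K\<close> have second differences bounded below by
  \<open>N (u - v) / 2\<close>, whereas its first differences are bounded by \<open>N u\<close>.\<close>

lemma N_separation:
  assumes "i < n" "u i \<noteq> v i"
  obtains z where "N (\<lambda>i. z i - u i) + N (\<lambda>i. z i + v i) < 2 * N z"
proof -
  define w where "w = (\<lambda>i. u i - v i)"
  have w: "0 < N w" using N_pos[of i w] assms by (simp add: w_def)
  define g where "g = (\<lambda>(K::nat) (s::nat). N (\<lambda>i. real K * w i + real s * u i))"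
  \<comment> \<open>\<open>S\<close> second differences of size \<open>N w / 2\<close> add up to
    more than \<open>2 * N u\<close>. \<open>K\<close> is then chosen so large that
    \<open>s * u\<close> with \<open>s \<le> S + 2\<close> has at most a quarter of the norm of
    \<open>K * w\<close>.\<close>
  obtain S :: nat where S: "4 * N u / N w < S" using reals_Archimedean2 by blast
  obtain K :: nat where K: "4 * (real S + 2) * N u / N w < K" using reals_Archimedean2 by blast
  have K0: "0 < K"
  proof -
    have "0 \<le> 4 * (real S + 2) * N u / N w" using w N_nonneg[of u] by simp
    with K have "0 < real K" by linarith
    then show ?thesis by simp
  qed
  \<comment> \<open>Convexity on the segment from \<open>s * u\<close> to
    \<open>K * w + s * u\<close>: the norm at its start is small compared with the norm at its end,
    so the average slope is at least \<open>N w / 2\<close>.\<close>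
  have step: "g (K - 1) s \<le> g K s - N w / 2" if "s \<le> S + 2" for s
  proof -
    have Nsu: "N (\<lambda>i. real s * u i) = real s * N u" by (simp add: N_scale)
    have "real K * g (K - 1) s = N (\<lambda>i. real K * (real (K - 1) * w i + real s * u i))"
      unfolding g_def by (subst N_scale) auto
    also have "\<dots> = N (\<lambda>i. real (K - 1) * (real K * w i + real s * u i) + real s * u i)"
      using K0 by (simp add: of_nat_diff algebra_simps)
    also have "\<dots> \<le> real (K - 1) * g K s + real s * N u"
      unfolding g_def by (rule order_trans[OF N_add]) (simp add: N_scale)
    finally have 1: "real K * g (K - 1) s \<le> real (K - 1) * g K s + real s * N u" .
    have "real K * N w = N (\<lambda>i. real K * w i)" by (simp add: N_scale)
    also have "\<dots> \<le> g K s + real s * N u"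
      using N_abs_diff_le[of "\<lambda>i. real K * w i + real s * u i" "\<lambda>i. real K * w i"] Nsu
      unfolding g_def by simp
    finally have 2: "real K * N w \<le> g K s + real s * N u" .
    have "4 * (real S + 2) * N u < real K * N w" using K w by (simp add: field_simps)
    moreover have "real s * N u \<le> (real S + 2) * N u"
      using that N_nonneg[of u] by (intro mult_right_mono) auto
    ultimately have 3: "4 * (real s * N u) \<le> real K * N w" by linarith
    have "real (K - 1) * g K s = real K * g K s - g K s"
      using K0 by (simp add: of_nat_diff algebra_simps)
    then have "real K * g (K - 1) s \<le> real K * (g K s - N w / 2)"
      using 1 2 3 by (simp add: algebra_simps)
    then show ?thesis using K0 by simp
  qed
  have lip_g: "\<bar>g K (Suc s) - g K s\<bar> \<le> N u" for s
    using N_abs_diff_le[of "\<lambda>i. real K * w i + real (Suc s) * u i" "\<lambda>i. real K * w i + real s * u i"]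
    unfolding g_def by (simp add: algebra_simps)
  show thesis
  proof (rule ccontr)
    assume "\<not> thesis"
    then have no: "2 * N z \<le> N (\<lambda>i. z i - u i) + N (\<lambda>i. z i + v i)" for z
      using that not_less by blast
    have second: "N w / 2 \<le> (g K (Suc (Suc s)) - g K (Suc s)) - (g K (Suc s) - g K s)" if "s \<le> S" for s
    proof -
      \<comment> \<open>For \<open>z = K w + (s + 1) u\<close>, subtracting \<open>u\<close> gives
        \<open>K w + s u\<close>, and adding \<open>v = u - w\<close> gives
        \<open>(K - 1) w + (s + 2) u\<close>.\<close>
      have "2 * g K (Suc s) \<le> g K s + g (K - 1) (Suc (Suc s))"
        using no[of "\<lambda>i. real K * w i + real (Suc s) * u i"] K0
        unfolding g_def w_def by (simp add: of_nat_diff algebra_simps)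
      with step[of "Suc (Suc s)"] that show ?thesis by simp
    qed
    have "real m * (N w / 2) \<le> (g K (Suc m) - g K m) - (g K 1 - g K 0)" if "m \<le> Suc S" for m
      using that
    proof (induction m)
      case (Suc m)
      then show ?case using second[of m] by (simp add: distrib_right add_divide_distrib)
    qed simp
    from this[of S] have "real S * (N w / 2) \<le> 2 * N u"
      using lip_g[of S] lip_g[of 0] by simp
    moreover have "4 * N u < real S * N w" using S w by (simp add: field_simps)
    ultimately show False by simp
  qed
qed

section \<open>Continuity and coercivity of the norm\<close>

lemma N_cong:
  assumes "\<And>i. i < n \<Longrightarrow> x i = x' i"
  shows "N x = N x'"
  using N_lipschitz[of x x'] assms by simp

lemma N_tendsto:
  assumes "\<And>i. i < n \<Longrightarrow> ((\<lambda>b. x b i) \<longlongrightarrow> l i) F"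
  shows "((\<lambda>b. N (x b)) \<longlongrightarrow> N l) F"
proof (rule tendsto_abs_diff_le_zero)
  show "\<bar>N (x b) - N l\<bar> \<le> lip * l1 (\<lambda>i. x b i - l i)" for b by (rule N_lipschitz)
  have "((\<lambda>b. lip * l1 (\<lambda>i. x b i - l i)) \<longlongrightarrow> lip * l1 (\<lambda>i. l i - l i)) F"
    by (intro tendsto_intros) (use assms in auto)
  then show "((\<lambda>b. lip * l1 (\<lambda>i. x b i - l i)) \<longlongrightarrow> 0) F" by simp
qed

text \<open>\<open>N\<close> attains a positive minimum on the compact Euclidean sphere, and scaling
  carries the bound to all vectors. For \<open>n = 0\<close> the sphere is empty and the claim is
  vacuous.\<close>

lemma coordinate_le_N:
  obtains B where "0 \<le> B" "\<And>x i. i < n \<Longrightarrow> \<bar>x i\<bar> \<le> B * N x"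
proof (cases "n = 0")
  case True
  then show ?thesis using that[of 0] by simp
next
  case False
  define S where "S = {x :: nat \<Rightarrow> real. (\<forall>i\<ge>n. x i = 0) \<and> (\<Sum>i<n. x i ^ 2) = 1}"
  have "(\<lambda>i. of_bool (i = 0)) \<in> S"
    using False by (auto simp: S_def of_bool_def if_distrib[where f = "\<lambda>a. a ^ 2"] cong: if_cong)
  then have "S \<noteq> {}" by blast
  moreover have "compact S" unfolding S_def by (rule compact_unit_sphere)
  moreover have "continuous_on S N"
    unfolding continuous_on_def
    by (intro ballI N_tendsto) (rule tendsto_fun_coordinate[OF tendsto_ident_at])
  ultimately obtain u where u: "u \<in> S" "\<And>v. v \<in> S \<Longrightarrow> N u \<le> N v"
    using continuous_attains_inf[of S N] by blast
  have "\<exists>i<n. u i \<noteq> 0"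
  proof (rule ccontr)
    assume "\<not> (\<exists>i<n. u i \<noteq> 0)"
    then have "(\<Sum>i<n. u i ^ 2) = 0" by simp
    with u show False by (simp add: S_def)
  qed
  then have pos: "0 < N u" using N_pos by blast
  show thesis
  proof (rule that[of "1 / N u"])
    show "0 \<le> 1 / N u" using pos by simp
    fix x :: "nat \<Rightarrow> real" and i assume i: "i < n"
    define r where "r = sqrt (\<Sum>i<n. x i ^ 2)"
    have "x i ^ 2 \<le> (\<Sum>i<n. x i ^ 2)" using i by (intro member_le_sum) auto
    then have xr: "\<bar>x i\<bar> \<le> r" unfolding r_def by (rule real_le_rsqrt[of "\<bar>x i\<bar>", simplified])
    show "\<bar>x i\<bar> \<le> 1 / N u * N x"
    proof (cases "r = 0")
      case True
      then show ?thesis using xr N_nonneg[of x] pos by simp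
    next
      case False
      then have r0: "0 < r" using xr by linarith
      have r2: "r ^ 2 = (\<Sum>i<n. x i ^ 2)" unfolding r_def by (simp add: sum_nonneg)
      define v where "v = (\<lambda>i. if i < n then x i / r else 0)"
      have "(\<Sum>i<n. v i ^ 2) = (\<Sum>i<n. x i ^ 2) / r ^ 2"
        by (simp add: v_def power_divide sum_divide_distrib)
      then have "(\<Sum>i<n. v i ^ 2) = 1" using r0 by (simp flip: r2)
      then have "v \<in> S" by (simp add: S_def v_def)
      then have "N u \<le> N v" by (rule u)
      then have "r * N u \<le> r * N v" using r0 by simp
      also have "\<dots> = N (\<lambda>i. r * v i)" using r0 by (simp add: N_scale)
      also have "\<dots> = N x" by (rule N_cong) (use r0 in \<open>simp add: v_def\<close>)
      finally have "r * N u \<le> N x" .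
      moreover have "\<bar>x i\<bar> * N u \<le> r * N u" using xr pos by simp
      ultimately have "\<bar>x i\<bar> * N u \<le> N x" by linarith
      then show ?thesis using pos by (simp add: field_simps)
    qed
  qed
qed

end

section \<open>Bicombings and rays\<close>

lemma bicombing_geodesic:
  assumes "bicombing \<sigma>"
  shows "\<sigma> x y 0 = x" "\<sigma> x y 1 = y"
    "s \<in> {0..1} \<Longrightarrow> t \<in> {0..1} \<Longrightarrow> dist (\<sigma> x y s) (\<sigma> x y t) = \<bar>s - t\<bar> * dist x y"
  using assms unfolding bicombing_def const_speed_geodesic_def by blast+

lemma bicombing_dist_start:
  assumes "bicombing \<sigma>" "t \<in> {0..1}"
  shows "dist x (\<sigma> x y t) = t * dist x y"
  using bicombing_geodesic(3)[OF assms(1), of 0 t x y] bicombing_geodesic(1)[OF assms(1)] assms(2)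
  by simp

lemma conicalD:
  assumes "conical \<sigma>" "t \<in> {0..1}"
  shows "dist (\<sigma> x y t) (\<sigma> x' y' t) \<le> (1 - t) * dist x x' + t * dist y y'"
  using assms unfolding conical_def by blast

text \<open>Conicality is applied to the geodesic from \<open>z\<close> to itself, which is constant
  because its speed is zero.\<close>

lemma conical_dist_point:
  assumes "bicombing \<sigma>" "conical \<sigma>" "t \<in> {0..1}"
  shows "dist (\<sigma> x y t) z \<le> (1 - t) * dist x z + t * dist y z"
proof -
  have "dist z (\<sigma> z z t) = 0" using bicombing_dist_start[OF assms(1,3), of z z] by simp
  then have "\<sigma> z z t = z" by simp
  then show ?thesis using conicalD[OF assms(2,3), of x y z z] by simp
qed

text \<open>Consistency only compares images; the parameter is recovered from the distance to
  \<open>x\<close>. The case \<open>t = 0\<close> is separate because consistency speaks of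
  nondegenerate intervals.\<close>

lemma consistent_initial_segment:
  assumes "bicombing \<sigma>" "consistent \<sigma>" "s \<in> {0..1}" "t \<in> {0..1}"
  shows "\<sigma> x (\<sigma> x y t) s = \<sigma> x y (s * t)"
proof (cases "t = 0")
  case True
  have "dist x (\<sigma> x x s) = 0" using bicombing_dist_start[OF assms(1,3), of x x] by simp
  with True show ?thesis by (simp add: bicombing_geodesic(1)[OF assms(1)])
next
  case False
  have "\<sigma> (\<sigma> x y 0) (\<sigma> x y t) ` {0..1} = \<sigma> x y ` {0..t}"
    using assms(2,4) False unfolding consistent_def by force
  then have "\<sigma> x (\<sigma> x y t) s \<in> \<sigma> x y ` {0..t}"
    using assms(3) by (auto simp: bicombing_geodesic(1)[OF assms(1)])
  then obtain r where r: "r \<in> {0..t}" "\<sigma> x (\<sigma> x y t) s = \<sigma> x y r" by blast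
  have r1: "r \<in> {0..1}" using r assms(4) by auto
  have st: "s * t \<in> {0..1}" using assms(3,4) by (auto intro: mult_le_one)
  have "r * dist x y = s * (t * dist x y)"
    using bicombing_dist_start[OF assms(1) r1, of x y] r(2)
      bicombing_dist_start[OF assms(1,3), of x "\<sigma> x y t"] bicombing_dist_start[OF assms(1,4), of x y]
    by simp
  then have "\<bar>r - s * t\<bar> * dist x y = 0" by (auto simp: algebra_simps)
  then have "dist (\<sigma> x y r) (\<sigma> x y (s * t)) = 0"
    using bicombing_geodesic(3)[OF assms(1) r1 st] by simp
  with r show ?thesis by simp
qed

text \<open>Again only images are given, and the distance to the origin of the ray determines the
  parameter.\<close>

lemma sigma_ray_eq:
  assumes "bicombing \<sigma>" "\<xi> \<in> sigma_rays \<sigma>" "0 \<le> t" "t \<le> T" "0 < T"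
  shows "\<sigma> (\<xi> 0) (\<xi> T) (t / T) = \<xi> t"
proof -
  have iso: "\<And>s t. 0 \<le> s \<Longrightarrow> 0 \<le> t \<Longrightarrow> dist (\<xi> s) (\<xi> t) = \<bar>s - t\<bar>"
    and im: "\<sigma> (\<xi> 0) (\<xi> T) ` {0..1} = \<xi> ` {0..T}"
    using assms unfolding sigma_rays_def by auto
  have tT: "t / T \<in> {0..1}" using assms by simp
  then have "\<sigma> (\<xi> 0) (\<xi> T) (t / T) \<in> \<xi> ` {0..T}" using im by blast
  then obtain r where r: "0 \<le> r" "r \<le> T" "\<sigma> (\<xi> 0) (\<xi> T) (t / T) = \<xi> r" by auto
  have "r = t / T * T"
    using bicombing_dist_start[OF assms(1) tT, of "\<xi> 0" "\<xi> T"] r iso[of 0 r] iso[of 0 T] assms(5)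
    by simp
  with r assms(5) show ?thesis by simp
qed

text \<open>Conicality pulls the bounded distance at time \<open>m\<close> back to time
  \<open>t\<close> with factor \<open>t / m\<close>, which tends to 0.\<close>

lemma asymptotic_rays_same_origin:
  assumes "bicombing \<sigma>" "conical \<sigma>" "(\<xi>, \<zeta>) \<in> asymptotic \<sigma>" "\<xi> 0 = \<zeta> 0"
  shows "\<xi> = \<zeta>"
proof -
  have rays: "\<xi> \<in> sigma_rays \<sigma>" "\<zeta> \<in> sigma_rays \<sigma>" using assms(3) by (auto simp: asymptotic_def)
  obtain B where B: "\<And>t. 0 \<le> t \<Longrightarrow> dist (\<xi> t) (\<zeta> t) \<le> B"
    using assms(3) unfolding asymptotic_def bdd_above_def by auto
  have "\<xi> t = \<zeta> t" if t: "0 \<le> t" for t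
  proof -
    have "dist (\<xi> t) (\<zeta> t) \<le> t * B / real m" if m: "m \<ge> nat \<lceil>t\<rceil> + 1" for m
    proof -
      have m': "t \<le> real m" "0 < real m" using m by linarith+
      have tm: "t / real m \<in> {0..1}" using t m' by simp
      have "dist (\<xi> t) (\<zeta> t) = dist (\<sigma> (\<xi> 0) (\<xi> m) (t / m)) (\<sigma> (\<zeta> 0) (\<zeta> m) (t / m))"
        using sigma_ray_eq[OF assms(1) rays(1) t m'] sigma_ray_eq[OF assms(1) rays(2) t m'] by simp
      also have "\<dots> \<le> t / m * dist (\<xi> m) (\<zeta> m)"
        using conicalD[OF assms(2) tm, of "\<xi> 0" "\<xi> m" "\<zeta> 0" "\<zeta> m"] assms(4) by simp
      also have "\<dots> \<le> t / m * B" using B[of m] t by (intro mult_left_mono) auto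
      finally show ?thesis by simp
    qed
    then have "dist (\<xi> t) (\<zeta> t) \<le> 0"
      by (intro LIMSEQ_le_const[OF lim_const_over_n[of "t * B"]]) blast
    then show ?thesis by simp
  qed
  moreover have "\<xi> \<in> extensional {0..}" "\<zeta> \<in> extensional {0..}"
    using rays by (auto simp: sigma_rays_def)
  ultimately show ?thesis by (auto intro: extensionalityI)
qed

text \<open>Uniqueness of the ray from a given origin gives the description operator its value on
  every class with a known representative at the base point.\<close>

lemma ray_from_class:
  assumes "bicombing \<sigma>" "conical \<sigma>" "\<xi> \<in> sigma_rays \<sigma>"
  shows "ray_from (\<xi> 0) (asymptotic \<sigma> `` {\<xi>}) = \<xi>"
  unfolding ray_from_def
proof (rule the_equality)
  show "\<xi> \<in> asymptotic \<sigma> `` {\<xi>} \<and> \<xi> 0 = \<xi> 0"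
    using equiv_class_self[OF equiv_asymptotic assms(3)] by simp
  fix \<zeta> assume "\<zeta> \<in> asymptotic \<sigma> `` {\<xi>} \<and> \<zeta> 0 = \<xi> 0"
  then show "\<zeta> = \<xi>" using asymptotic_rays_same_origin[OF assms(1,2), of \<xi> \<zeta>] by simp
qed

section \<open>Separation in the boundary topology\<close>

lemma openin_boundary_nbhd:
  assumes "c \<in> boundary \<sigma>" "0 \<le> t" "0 < e"
  shows "openin (boundary_topology \<sigma> p) (boundary_nbhd \<sigma> p c t e)"
  unfolding boundary_topology_def by (rule topology_generated_by_Basis) (use assms in blast)

text \<open>At a time when two rays differ, neighbourhoods of half their distance are disjoint. The
  relative form suits the image of the sphere, whose rays from \<open>p\<close> are known
  explicitly.\<close>

lemma Hausdorff_space_subtopology_boundary: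
  assumes "S \<subseteq> boundary \<sigma>"
    and "\<And>c c'. c \<in> S \<Longrightarrow> c' \<in> S \<Longrightarrow> (\<And>t. 0 \<le> t \<Longrightarrow> ray_from p c t = ray_from p c' t) \<Longrightarrow> c = c'"
  shows "Hausdorff_space (subtopology (boundary_topology \<sigma> p) S)"
  unfolding Hausdorff_space_def
proof (intro allI impI, elim conjE)
  fix c c' assume c: "c \<in> topspace (subtopology (boundary_topology \<sigma> p) S)"
    "c' \<in> topspace (subtopology (boundary_topology \<sigma> p) S)" "c \<noteq> c'"
  then have cS: "c \<in> S" "c' \<in> S" by auto
  then have cb: "c \<in> boundary \<sigma>" "c' \<in> boundary \<sigma>" using assms(1) by auto
  from cS c(3) assms(2) obtain t where t: "0 \<le> t" "ray_from p c t \<noteq> ray_from p c' t" by blast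
  define e where "e = dist (ray_from p c t) (ray_from p c' t) / 2"
  have e: "0 < e" using t by (simp add: e_def)
  let ?U = "boundary_nbhd \<sigma> p c t e" and ?V = "boundary_nbhd \<sigma> p c' t e"
  have "openin (subtopology (boundary_topology \<sigma> p) S) (S \<inter> ?U)"
    "openin (subtopology (boundary_topology \<sigma> p) S) (S \<inter> ?V)"
    using cb t e by (auto intro!: openin_subtopology_Int2 openin_boundary_nbhd)
  moreover have "c \<in> S \<inter> ?U" "c' \<in> S \<inter> ?V"
    using cS cb e by (auto simp: boundary_nbhd_def)
  moreover have "disjnt (S \<inter> ?U) (S \<inter> ?V)"
  proof -
    have False if "d \<in> ?U" "d \<in> ?V" for d
      using that dist_triangle[of "ray_from p c t" "ray_from p c' t" "ray_from p d t"]
      unfolding boundary_nbhd_def e_def by (simp add: dist_commute)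
    then show ?thesis by (auto simp: disjnt_def)
  qed
  ultimately show "\<exists>U V. openin (subtopology (boundary_topology \<sigma> p) S) U \<and>
      openin (subtopology (boundary_topology \<sigma> p) S) V \<and> c \<in> U \<and> c' \<in> V \<and> disjnt U V"
    by blast
qed

section \<open>The sphere of limit rays\<close>

text \<open>Of the group only the orbit of the minimizing point is retained. The base point
  \<open>p\<close> is arbitrary and may lie off the orbit.\<close>

locale normed_orbit = integer_norm n q for n q +
  fixes \<sigma> :: "'a::metric_space \<Rightarrow> 'a \<Rightarrow> real \<Rightarrow> 'a" and Y :: "(nat \<Rightarrow> int) \<Rightarrow> 'a" and p :: 'a
  assumes proper: "compact (cball (x::'a) r)"
    and bicombing: "bicombing \<sigma>"
    and consistent: "consistent \<sigma>"
    and conical: "conical \<sigma>"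
    and dist_Y: "dist (Y k) (Y l) = q (\<lambda>i. k i - l i)"
begin

text \<open>The clamping, with \<open>t / 0 = 0\<close>, keeps the last argument in \<open>[0, 1]\<close> for all \<open>m\<close> and \<open>t\<close>.\<close>

definition pt :: "nat \<Rightarrow> (nat \<Rightarrow> real) \<Rightarrow> real \<Rightarrow> 'a" where
  "pt m x t = \<sigma> p (Y (floor_vec m x)) (max 0 (min 1 (t / real m)))"

text \<open>One constant for two errors: moving the base point from \<open>Y 0\<close> to
  \<open>p\<close>, and rounding.\<close>

definition err :: real where
  "err = dist p (Y (\<lambda>_. 0)) + lip * n"

lemma lip_n_le_err: "lip * n \<le> err"
  by (simp add: err_def)

lemma err_nonneg: "0 \<le> err"
  by (simp add: err_def lip_nonneg)

lemma dist_p_Y: "\<bar>dist p (Y k) - q k\<bar> \<le> dist p (Y (\<lambda>_. 0))"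
  using dist_triangle[of p "Y k" "Y (\<lambda>_. 0)"] dist_triangle[of "Y k" "Y (\<lambda>_. 0)" p]
    dist_Y[of k "\<lambda>_. 0"] by (simp add: dist_commute)

lemma dist_p_floor_vec: "\<bar>dist p (Y (floor_vec m x)) - real m * N x\<bar> \<le> err"
  using dist_p_Y[of "floor_vec m x"] q_floor_vec[of m x] unfolding err_def by linarith

lemma pt_eq:
  assumes "0 \<le> t" "t \<le> real m"
  shows "pt m x t = \<sigma> p (Y (floor_vec m x)) (t / real m)"
  using assms by (cases "m = 0") (auto simp: pt_def)

text \<open>Independent of \<open>m\<close> and valid for all real \<open>t\<close>: each pair of
  \<open>x\<close> and \<open>t\<close> gets a fixed compact ball, as the Tychonoff argument
  requires.\<close>

lemma pt_bounded: "dist p (pt m x t) \<le> \<bar>t\<bar> * (N x + err)"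
proof -
  define \<tau> where "\<tau> = max 0 (min 1 (t / real m))"
  have \<tau>: "\<tau> \<in> {0..1}" by (simp add: \<tau>_def)
  have "\<tau> * (real m * N x + err) \<le> \<bar>t\<bar> * (N x + err)"
  proof (cases "m = 0")
    case True
    then show ?thesis using N_nonneg[of x] err_nonneg by (simp add: \<tau>_def)
  next
    case False
    then have m: "1 \<le> real m" by linarith
    have "\<tau> \<le> \<bar>t\<bar> / real m" unfolding \<tau>_def
      by (simp add: divide_right_mono min.coboundedI2)
    then have "\<tau> * (real m * N x + err) \<le> \<bar>t\<bar> / real m * (real m * N x + err)"
      using N_nonneg[of x] err_nonneg by (intro mult_right_mono) auto
    also have "\<dots> \<le> \<bar>t\<bar> / real m * (real m * (N x + err))"
      using m err_nonneg mult_right_mono[OF m err_nonneg]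
      by (intro mult_left_mono) (auto simp: distrib_left)
    also have "\<dots> = \<bar>t\<bar> * (N x + err)" using m by simp
    finally show ?thesis .
  qed
  moreover have "dist p (pt m x t) = \<tau> * dist p (Y (floor_vec m x))"
    unfolding pt_def \<tau>_def[symmetric] by (rule bicombing_dist_start[OF bicombing \<tau>])
  moreover have "\<tau> * dist p (Y (floor_vec m x)) \<le> \<tau> * (real m * N x + err)"
    using \<tau> dist_p_floor_vec[of m x] by (intro mult_left_mono) auto
  ultimately show ?thesis by linarith
qed

end

text \<open>One filter serves all vectors and times, so that relations between different rays pass
  to the limit.\<close>

locale normed_orbit_limit = normed_orbit n q \<sigma> Y p for n q \<sigma> Y and p :: "'a::metric_space" +
  fixes F :: "nat filter" and R :: "(nat \<Rightarrow> real) \<Rightarrow> real \<Rightarrow> 'a"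
  assumes F_nontrivial: "F \<noteq> bot" and F_le: "F \<le> sequentially"
    and R: "((\<lambda>m. pt m x t) \<longlongrightarrow> R x t) F"
begin

lemma eventually_large: "eventually (\<lambda>m. 0 < m \<and> t \<le> real m) F"
proof (rule filter_leD[OF F_le])
  obtain k :: nat where "t \<le> k" using real_arch_simple by blast
  then show "eventually (\<lambda>m. 0 < m \<and> t \<le> real m) sequentially"
    by (intro eventually_sequentiallyI[of "Suc k"]) (auto simp: less_eq_Suc_le)
qed

lemma tendsto_F: "(f \<longlonglongrightarrow> l) \<Longrightarrow> (f \<longlongrightarrow> l) F"
  using F_le by (rule tendsto_mono)

lemma R_at_0: "R x 0 = p"
proof -
  have "pt m x 0 = p" for m by (simp add: pt_def bicombing_geodesic(1)[OF bicombing])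
  then have "((\<lambda>m. p) \<longlongrightarrow> R x 0) F" using R[of x 0] by simp
  then show ?thesis using tendsto_unique[OF F_nontrivial _ tendsto_const] by blast
qed

text \<open>With parameter \<open>t / m\<close>, the geodesic to \<open>Y (floor_vec m x)\<close>
  has speed \<open>dist p (Y (floor_vec m x)) / m\<close>, which tends to
  \<open>N x\<close>.\<close>

lemma R_dist:
  assumes "0 \<le> s" "0 \<le> t"
  shows "dist (R x s) (R x t) = \<bar>s - t\<bar> * N x"
proof -
  have "(\<lambda>m. dist p (Y (floor_vec m x)) / real m) \<longlonglongrightarrow> N x"
  proof (rule Lim_transform_eventually)
    let ?h = "\<lambda>m. dist p (Y (floor_vec m x)) - real m * N x"
    have "(\<lambda>m. ?h m / real m) \<longlonglongrightarrow> 0"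
      by (rule Lim_null_comparison[OF _ lim_const_over_n[of err]])
         (auto intro!: always_eventually divide_right_mono dist_p_floor_vec)
    then show "(\<lambda>m. N x + ?h m / real m) \<longlonglongrightarrow> N x"
      using tendsto_add[OF tendsto_const[of "N x"]] by fastforce
    show "\<forall>\<^sub>F m in sequentially. N x + ?h m / real m = dist p (Y (floor_vec m x)) / real m"
      by (rule eventually_sequentiallyI[of 1]) (simp add: field_simps)
  qed
  then have 1: "((\<lambda>m. \<bar>s - t\<bar> * (dist p (Y (floor_vec m x)) / real m)) \<longlongrightarrow> \<bar>s - t\<bar> * N x) F"
    by (intro tendsto_intros tendsto_F)
  have "((\<lambda>m. dist (pt m x s) (pt m x t)) \<longlongrightarrow> \<bar>s - t\<bar> * N x) F"
  proof (rule Lim_transform_eventually[OF 1])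
    show "\<forall>\<^sub>F m in F. \<bar>s - t\<bar> * (dist p (Y (floor_vec m x)) / real m) = dist (pt m x s) (pt m x t)"
      using eventually_large[of s] eventually_large[of t]
    proof eventually_elim
      case (elim m)
      then have "dist (pt m x s) (pt m x t) = \<bar>s / real m - t / real m\<bar> * dist p (Y (floor_vec m x))"
        using assms by (simp add: pt_eq bicombing_geodesic(3)[OF bicombing])
      also have "\<bar>s / real m - t / real m\<bar> = \<bar>s - t\<bar> / real m"
        by (metis abs_divide abs_of_nat diff_divide_distrib)
      finally show ?case by simp
    qed
  qed
  with tendsto_dist[OF R R] show ?thesis by (rule tendsto_unique[OF F_nontrivial])
qed

text \<open>Consistency gives the identity for each \<open>pt m x\<close>, and conicality makes
  \<open>\<sigma> p _ s\<close> continuous, so it survives in the limit.\<close>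

lemma R_sigma:
  assumes "s \<in> {0..1}" "0 \<le> t"
  shows "\<sigma> p (R x t) s = R x (s * t)"
proof (rule tendsto_unique[OF F_nontrivial _ R])
  have "((\<lambda>m. \<sigma> p (pt m x t) s) \<longlongrightarrow> \<sigma> p (R x t) s) F"
  proof (rule metric_tendsto_imp_tendsto[OF R[of x t]], rule always_eventually, rule allI)
    fix m
    have "dist (\<sigma> p (pt m x t) s) (\<sigma> p (R x t) s) \<le> s * dist (pt m x t) (R x t)"
      using conicalD[OF conical assms(1), of p "pt m x t" p "R x t"] by simp
    also have "\<dots> \<le> dist (pt m x t) (R x t)" using assms(1) by (simp add: mult_left_le_one_le)
    finally show "dist (\<sigma> p (pt m x t) s) (\<sigma> p (R x t) s) \<le> dist (pt m x t) (R x t)" .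
  qed
  moreover have "\<forall>\<^sub>F m in F. \<sigma> p (pt m x t) s = pt m x (s * t)"
    using eventually_large[of t]
  proof eventually_elim
    case (elim m)
    have "s * t \<le> real m" using elim assms by (metis atLeastAtMost_iff mult_left_le_one_le order_trans)
    with elim assms show ?case
      by (simp add: pt_eq consistent_initial_segment[OF bicombing consistent])
  qed
  ultimately show "((\<lambda>m. pt m x (s * t)) \<longlongrightarrow> \<sigma> p (R x t) s) F"
    by (rule Lim_transform_eventually)
qed

lemma pt_dist_le:
  assumes "0 \<le> t" "t \<le> real m" "0 < m"
  shows "dist (pt m x t) (\<sigma> p z (t / real m)) \<le> t / real m * dist (Y (floor_vec m x)) z"
  using conicalD[OF conical, of "t / real m" p "Y (floor_vec m x)" p z] assms
  by (simp add: pt_eq)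

lemma floor_vec_diff_le:
  "\<bar>of_int (floor_vec m x i) - real m * y\<bar> \<le> real m * \<bar>x i - y\<bar> + 1"
proof -
  have "real m * \<bar>x i - y\<bar> = \<bar>real m * x i - real m * y\<bar>"
    by (metis abs_mult abs_of_nat right_diff_distrib)
  then show ?thesis using abs_floor_vec[of m x i] by linarith
qed

text \<open>The far endpoints are at distance at most \<open>m\<close> times the l1 term plus a
  rounding error; conicality contracts this by \<open>t / m\<close>.\<close>

lemma R_lipschitz:
  assumes "0 \<le> t"
  shows "dist (R x t) (R x' t) \<le> t * lip * l1 (\<lambda>i. x i - x' i)"
proof (rule tendsto_le[OF F_nontrivial _ tendsto_dist[OF R R]])
  have "(\<lambda>m. t * lip * l1 (\<lambda>i. x i - x' i) + 2 * t * lip * n / real m)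
      \<longlonglongrightarrow> t * lip * l1 (\<lambda>i. x i - x' i)"
    using tendsto_add[OF tendsto_const lim_const_over_n[of "2 * t * lip * n"]] by fastforce
  then show "((\<lambda>m. t * lip * l1 (\<lambda>i. x i - x' i) + 2 * t * lip * n / real m)
      \<longlongrightarrow> t * lip * l1 (\<lambda>i. x i - x' i)) F"
    by (rule tendsto_F)
  show "\<forall>\<^sub>F m in F. dist (pt m x t) (pt m x' t)
      \<le> t * lip * l1 (\<lambda>i. x i - x' i) + 2 * t * lip * n / real m"
    using eventually_large[of t]
  proof eventually_elim
    case (elim m)
    have "dist (Y (floor_vec m x)) (Y (floor_vec m x'))
        \<le> lip * (\<Sum>i<n. \<bar>of_int (floor_vec m x i) - of_int (floor_vec m x' i)\<bar>)"
      unfolding dist_Y by (rule q_diff_le_real)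
    also have "\<dots> \<le> lip * (\<Sum>i<n. real m * \<bar>x i - x' i\<bar> + 2)"
    proof (intro mult_left_mono sum_mono lip_nonneg)
      fix i
      show "\<bar>real_of_int (floor_vec m x i) - of_int (floor_vec m x' i)\<bar> \<le> real m * \<bar>x i - x' i\<bar> + 2"
        using floor_vec_diff_le[of m x i "x' i"] abs_floor_vec[of m x' i] by linarith
    qed
    also have "\<dots> = real m * (lip * l1 (\<lambda>i. x i - x' i)) + 2 * (lip * n)"
      by (simp add: sum.distrib sum_distrib_left algebra_simps)
    finally have "t / real m * dist (Y (floor_vec m x)) (Y (floor_vec m x'))
        \<le> t / real m * (real m * (lip * l1 (\<lambda>i. x i - x' i)) + 2 * (lip * n))"
      using assms by (intro mult_left_mono) auto
    also have "\<dots> = t * lip * l1 (\<lambda>i. x i - x' i) + 2 * t * lip * n / real m"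
      using elim by (simp add: field_simps)
    finally show ?case
      using pt_dist_le[of t m x "Y (floor_vec m x')"] elim assms pt_eq[of t m x'] by simp
  qed
qed

text \<open>By conicality the distance to \<open>Y (floor_vec m z)\<close> is bounded by linear
  interpolation between about \<open>m * N z\<close> at \<open>p\<close> and about
  \<open>m * N (x - z)\<close> at the other end; the parameter is \<open>t / m\<close>. The term
  \<open>3 * err\<close> covers the errors at both ends.\<close>

lemma pt_dist_Y_le:
  assumes "0 \<le> t" "t \<le> real m" "0 < m"
  shows "dist (pt m x t) (Y (floor_vec m z))
      \<le> real m * N z + t * (N (\<lambda>i. x i - z i) - N z) + 3 * err"
proof -
  define \<tau> where "\<tau> = t / real m"
  have \<tau>: "\<tau> \<in> {0..1}" "\<tau> * real m = t" using assms by (auto simp: \<tau>_def)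
  have 1: "dist p (Y (floor_vec m z)) \<le> real m * N z + 3 * err"
    using dist_p_floor_vec[of m z] err_nonneg by simp
  have 2: "dist (Y (floor_vec m x)) (Y (floor_vec m z)) \<le> real m * N (\<lambda>i. x i - z i) + 3 * err"
  proof -
    let ?w = "\<lambda>i. x i - z i"
    have "N (\<lambda>i. of_int (floor_vec m x i - floor_vec m z i)) - N (\<lambda>i. real m * ?w i)
        \<le> lip * l1 (\<lambda>i. of_int (floor_vec m x i - floor_vec m z i) - real m * ?w i)"
      using N_lipschitz[of "\<lambda>i. of_int (floor_vec m x i - floor_vec m z i)" "\<lambda>i. real m * ?w i"]
      by simp
    also have "\<dots> \<le> lip * (\<Sum>i<n. 2)"
    proof (intro mult_left_mono sum_mono lip_nonneg)
      fix i
      show "\<bar>real_of_int (floor_vec m x i - floor_vec m z i) - real m * ?w i\<bar> \<le> 2"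
        using abs_floor_vec[of m x i] abs_floor_vec[of m z i] by (simp add: right_diff_distrib)
    qed
    finally have "N (\<lambda>i. of_int (floor_vec m x i - floor_vec m z i)) - N (\<lambda>i. real m * ?w i)
        \<le> 2 * (lip * n)" by simp
    moreover have "N (\<lambda>i. of_int (floor_vec m x i - floor_vec m z i))
        = dist (Y (floor_vec m x)) (Y (floor_vec m z))"
      unfolding dist_Y by (rule N_of_int)
    moreover have "N (\<lambda>i. real m * ?w i) = real m * N ?w" by (rule N_scale) simp
    ultimately show ?thesis using lip_n_le_err err_nonneg by linarith
  qed
  have "dist (pt m x t) (Y (floor_vec m z))
      \<le> (1 - \<tau>) * dist p (Y (floor_vec m z)) + \<tau> * dist (Y (floor_vec m x)) (Y (floor_vec m z))"
    using conical_dist_point[OF bicombing conical \<tau>(1)] assms by (simp add: pt_eq \<tau>_def)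
  also have "\<dots> \<le> (1 - \<tau>) * (real m * N z + 3 * err) + \<tau> * (real m * N (\<lambda>i. x i - z i) + 3 * err)"
    using \<tau> 1 2 by (intro add_mono mult_left_mono) auto
  also have "\<dots> = real m * N z + (\<tau> * real m) * (N (\<lambda>i. x i - z i) - N z) + 3 * err"
    by (simp add: algebra_simps)
  finally show ?thesis by (simp add: \<tau>(2))
qed

text \<open>The points \<open>Y (\<plusminus> m z)\<close> are at distance \<open>2 m N z\<close> up to a bounded error, and conicality bounds
  their distances to points on the two geodesics from above.\<close>

lemma R_separation:
  assumes "0 \<le> t"
  shows "t * (2 * N z - N (\<lambda>i. z i - x i) - N (\<lambda>i. z i + x' i)) - 9 * err \<le> dist (R x t) (R x' t)"
proof (rule tendsto_lowerbound[OF tendsto_dist[OF R R] _ F_nontrivial])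
  show "\<forall>\<^sub>F m in F. t * (2 * N z - N (\<lambda>i. z i - x i) - N (\<lambda>i. z i + x' i)) - 9 * err
      \<le> dist (pt m x t) (pt m x' t)"
    using eventually_large[of t]
  proof eventually_elim
    case (elim m)
    let ?z' = "\<lambda>i. - z i"
    have "2 * q (floor_vec m z) = q (\<lambda>i. 2 * floor_vec m z i)" by (simp add: q_double)
    also have "\<dots> \<le> q (\<lambda>i. floor_vec m z i - floor_vec m ?z' i) + lip * n"
    proof -
      have "q (\<lambda>i. 2 * floor_vec m z i) - q (\<lambda>i. floor_vec m z i - floor_vec m ?z' i)
        \<le> lip * (\<Sum>i<n. \<bar>of_int (2 * floor_vec m z i) - of_int (floor_vec m z i - floor_vec m ?z' i)\<bar>)"
        using q_diff_le q_diff_le_real order_trans by blast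
      also have "\<dots> \<le> lip * (\<Sum>i<n. 1)"
      proof (intro mult_left_mono sum_mono lip_nonneg)
        fix i
        have "\<bar>floor_vec m z i + floor_vec m ?z' i\<bar> \<le> 1"
          unfolding floor_vec_def by simp linarith
        then have "\<bar>real_of_int (floor_vec m z i + floor_vec m ?z' i)\<bar> \<le> 1" by linarith
        then show "\<bar>real_of_int (2 * floor_vec m z i) - of_int (floor_vec m z i - floor_vec m ?z' i)\<bar> \<le> 1"
          by simp
      qed
      finally show ?thesis by simp
    qed
    finally have 1: "2 * (real m * N z) - 2 * err \<le> dist (Y (floor_vec m z)) (Y (floor_vec m ?z')) + lip * n"
      using q_floor_vec[of m z] lip_n_le_err by (simp add: dist_Y)
    have 2: "dist (pt m x t) (Y (floor_vec m z)) \<le> real m * N z + t * (N (\<lambda>i. z i - x i) - N z) + 3 * err"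
      using pt_dist_Y_le[of t m x z] elim assms by (simp add: N_diff_commute[of x z])
    have 3: "dist (pt m x' t) (Y (floor_vec m ?z'))
        \<le> real m * N z + t * (N (\<lambda>i. z i + x' i) - N z) + 3 * err"
      using pt_dist_Y_le[of t m x' ?z'] elim assms by (simp add: N_minus add.commute)
    have "dist (Y (floor_vec m z)) (Y (floor_vec m ?z')) \<le> dist (pt m x t) (Y (floor_vec m z))
        + dist (pt m x t) (pt m x' t) + dist (pt m x' t) (Y (floor_vec m ?z'))"
      using dist_triangle[of "Y (floor_vec m z)" "Y (floor_vec m ?z')" "pt m x t"]
        dist_triangle[of "pt m x t" "Y (floor_vec m ?z')" "pt m x' t"]
      by (simp add: dist_commute)
    \<comment> \<open>The total error is \<open>9 * err\<close>: 3 from each of the two upper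
      bounds, 2 from comparing \<open>q\<close> with \<open>N\<close> at \<open>z\<close>, and 1
      from rounding \<open>- z\<close>.\<close>
    with 1 2 3 have "2 * (real m * N z) - 2 * err - lip * n \<le> dist (pt m x t) (pt m x' t)
      + 2 * (real m * N z) + t * (N (\<lambda>i. z i - x i) - N z) + t * (N (\<lambda>i. z i + x' i) - N z) + 6 * err"
      by linarith
    moreover have "t * (N (\<lambda>i. z i - x i) - N z) + t * (N (\<lambda>i. z i + x' i) - N z)
      = - (t * (2 * N z - N (\<lambda>i. z i - x i) - N (\<lambda>i. z i + x' i)))"
      by (simp add: algebra_simps)
    ultimately show ?case using lip_n_le_err err_nonneg by linarith
  qed
qed

end

section \<open>Embedding of the sphere by limit rays\<close>

context normed_orbit_limit
begin

definition ray :: "(nat \<Rightarrow> real) \<Rightarrow> real \<Rightarrow> 'a" where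
  "ray x = restrict (R x) {0..}"

lemma ray_apply: "0 \<le> t \<Longrightarrow> ray x t = R x t"
  by (simp add: ray_def)

lemma ray_at_0: "ray x 0 = p"
  by (simp add: ray_apply R_at_0)

lemma ray_in_sigma_rays:
  assumes "N x = 1"
  shows "ray x \<in> sigma_rays \<sigma>"
proof -
  have "\<sigma> (ray x 0) (ray x t) ` {0..1} = ray x ` {0..t}" if t: "0 \<le> t" for t
  proof
    show "\<sigma> (ray x 0) (ray x t) ` {0..1} \<subseteq> ray x ` {0..t}"
    proof
      fix z assume "z \<in> \<sigma> (ray x 0) (ray x t) ` {0..1}"
      then obtain s where s: "s \<in> {0..1}" "z = \<sigma> p (R x t) s"
        using t by (auto simp: ray_apply R_at_0)
      then have "z = ray x (s * t)" using t by (simp add: R_sigma ray_apply)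
      moreover have "s * t \<in> {0..t}" using s t by (simp add: mult_left_le_one_le)
      ultimately show "z \<in> ray x ` {0..t}" by blast
    qed
    show "ray x ` {0..t} \<subseteq> \<sigma> (ray x 0) (ray x t) ` {0..1}"
    proof
      fix z assume "z \<in> ray x ` {0..t}"
      then obtain r where r: "0 \<le> r" "r \<le> t" "z = R x r" by (auto simp: ray_apply)
      \<comment> \<open>If \<open>t = 0\<close>, then \<open>r = 0\<close> too, and
        \<open>0 / 0 = 0\<close> still gives \<open>s * t = r\<close>.\<close>
      define s where "s = r / t"
      have s: "s \<in> {0..1}" "s * t = r" using r by (auto simp: s_def divide_le_eq_1)
      then have "z = \<sigma> (ray x 0) (ray x t) s"
        using t r R_sigma[OF s(1) t, of x] by (simp add: ray_apply R_at_0)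
      with s show "z \<in> \<sigma> (ray x 0) (ray x t) ` {0..1}" by blast
    qed
  qed
  then show ?thesis
    unfolding sigma_rays_def using R_dist[of _ _ x] assms
    by (auto simp: ray_apply) (simp add: ray_def)
qed

text \<open>A vector \<open>z\<close> from \<open>N_separation\<close> makes the lower bound of
  \<open>R_separation\<close> grow linearly in \<open>t\<close>.\<close>

lemma ray_asymptotic_imp_eq:
  assumes "(ray x, ray x') \<in> asymptotic \<sigma>" "i < n"
  shows "x i = x' i"
proof (rule ccontr)
  assume "x i \<noteq> x' i"
  then obtain z where z: "N (\<lambda>i. z i - x i) + N (\<lambda>i. z i + x' i) < 2 * N z"
    using N_separation[OF assms(2)] by blast
  define d where "d = 2 * N z - N (\<lambda>i. z i - x i) - N (\<lambda>i. z i + x' i)"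
  have d: "0 < d" using z by (simp add: d_def)
  obtain B where B: "\<And>t. 0 \<le> t \<Longrightarrow> dist (ray x t) (ray x' t) \<le> B"
    using assms(1) unfolding asymptotic_def bdd_above_def by auto
  obtain t :: nat where "(B + 9 * err) / d < t" using reals_Archimedean2 by blast
  then have "B < t * d - 9 * err" using d by (simp add: field_simps)
  also have "\<dots> \<le> dist (R x t) (R x' t)"
    unfolding d_def by (rule R_separation) simp
  also have "\<dots> \<le> B" using B[of t] by (simp add: ray_apply)
  finally show False by simp
qed

abbreviation usphere :: "(nat \<Rightarrow> real) set" where
  "usphere \<equiv> {x. (\<forall>i\<ge>n. x i = 0) \<and> (\<Sum>i<n. x i ^ 2) = 1}"

text \<open>Radial projection of the Euclidean sphere to the unit sphere of \<open>N\<close>, where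
  limit rays have unit speed.\<close>

definition \<Phi> :: "(nat \<Rightarrow> real) \<Rightarrow> (real \<Rightarrow> 'a) set" where
  "\<Phi> u = asymptotic \<sigma> `` {ray (\<lambda>i. u i / N u)}"

lemma N_sphere_pos:
  assumes "u \<in> usphere"
  shows "0 < N u"
proof -
  have "\<exists>i<n. u i \<noteq> 0"
  proof (rule ccontr)
    assume "\<not> (\<exists>i<n. u i \<noteq> 0)"
    then have "(\<Sum>i<n. u i ^ 2) = 0" by simp
    with assms show False by simp
  qed
  then show ?thesis using N_pos by blast
qed

lemma N_normalized:
  assumes "0 < N u"
  shows "N (\<lambda>i. u i / N u) = 1"
  using N_scale[of "1 / N u" u] assms by simp

lemma ray_sphere: "u \<in> usphere \<Longrightarrow> ray (\<lambda>i. u i / N u) \<in> sigma_rays \<sigma>"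
  by (rule ray_in_sigma_rays) (rule N_normalized, rule N_sphere_pos)

lemma \<Phi>_in_boundary: "u \<in> usphere \<Longrightarrow> \<Phi> u \<in> boundary \<sigma>"
  unfolding \<Phi>_def boundary_def by (rule quotientI) (rule ray_sphere)

lemma ray_from_\<Phi>: "u \<in> usphere \<Longrightarrow> ray_from p (\<Phi> u) = ray (\<lambda>i. u i / N u)"
  unfolding \<Phi>_def using ray_from_class[OF bicombing conical ray_sphere[of u]] by (simp add: ray_at_0)

text \<open>Equal classes force equal normalized vectors, so \<open>u\<close> is a positive multiple
  of \<open>v\<close>, and both have Euclidean length 1.\<close>

lemma inj_on_\<Phi>: "inj_on \<Phi> usphere"
proof (rule inj_onI)
  fix u v assume u: "u \<in> usphere" and v: "v \<in> usphere" and eq: "\<Phi> u = \<Phi> v"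
  have "(ray (\<lambda>i. u i / N u), ray (\<lambda>i. v i / N v)) \<in> asymptotic \<sigma>"
    using eq_equiv_class_iff[OF equiv_asymptotic ray_sphere[OF u] ray_sphere[OF v]] eq
    by (simp add: \<Phi>_def)
  then have uv: "u i / N u = v i / N v" if "i < n" for i
    using ray_asymptotic_imp_eq that by fastforce
  have Nu: "0 < N u" and Nv: "0 < N v" using N_sphere_pos u v by blast+
  define c where "c = N u / N v"
  have c: "0 < c" using Nu Nv by (simp add: c_def)
  have uc: "u i = c * v i" if "i < n" for i
    using uv[OF that] Nu Nv by (simp add: c_def field_simps)
  have "(\<Sum>i<n. u i ^ 2) = c ^ 2 * (\<Sum>i<n. v i ^ 2)"
    by (simp add: uc power_mult_distrib sum_distrib_left)
  then have "c ^ 2 = 1" using u v by simp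
  then have "c = 1" using c by (simp add: power2_eq_1_iff)
  then have "u i = v i" for i using uc u v by (cases "i < n") auto
  then show "u = v" by (rule ext)
qed

text \<open>A generating neighbourhood tests rays at a single time \<open>t\<close>, and at that
  time the limit ray depends continuously on \<open>u\<close> by \<open>R_lipschitz\<close>.\<close>

lemma continuous_map_\<Phi>: "continuous_map (top_of_set usphere) (boundary_topology \<sigma> p) \<Phi>"
  unfolding boundary_topology_def
proof (rule continuous_on_generated_topo)
  show "\<Phi> ` topspace (top_of_set usphere)
      \<subseteq> \<Union>{boundary_nbhd \<sigma> p c t e |c t e. c \<in> boundary \<sigma> \<and> 0 \<le> t \<and> 0 < e}"
    using topspace_boundary_topology[of \<sigma> p] \<Phi>_in_boundary
    unfolding boundary_topology_def topology_generated_by_topspace by auto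
  fix U assume "U \<in> {boundary_nbhd \<sigma> p c t e |c t e. c \<in> boundary \<sigma> \<and> 0 \<le> t \<and> 0 < e}"
  then obtain c t e where U: "U = boundary_nbhd \<sigma> p c t e" and t: "0 \<le> t" by blast
  let ?h = "\<lambda>u. R (\<lambda>i. u i / N u) t"
  have "continuous_on usphere ?h"
    unfolding continuous_on_def
  proof (rule ballI)
    fix u assume u: "u \<in> usphere"
    have coord: "((\<lambda>v. v i) \<longlongrightarrow> u i) (at u within usphere)" for i
      by (rule tendsto_fun_coordinate[OF tendsto_ident_at])
    have "((\<lambda>v. t * lip * l1 (\<lambda>i. v i / N v - u i / N u))
        \<longlongrightarrow> t * lip * l1 (\<lambda>i. u i / N u - u i / N u)) (at u within usphere)"
      using N_sphere_pos[OF u] by (intro tendsto_intros coord N_tendsto) auto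
    then have "((\<lambda>v. t * lip * l1 (\<lambda>i. v i / N v - u i / N u)) \<longlongrightarrow> 0) (at u within usphere)"
      by simp
    then show "(?h \<longlongrightarrow> ?h u) (at u within usphere)"
      by (rule metric_tendsto_imp_tendsto)
         (auto intro!: always_eventually order_trans[OF R_lipschitz[OF t]])
  qed
  then have "continuous_on usphere (\<lambda>u. dist (?h u) (ray_from p c t))"
    by (intro continuous_intros)
  then have "openin (top_of_set usphere) (usphere \<inter> (\<lambda>u. dist (?h u) (ray_from p c t)) -` {..<e})"
    by (rule continuous_openin_preimage_gen) simp
  moreover have "\<Phi> -` U \<inter> topspace (top_of_set usphere)
      = usphere \<inter> (\<lambda>u. dist (?h u) (ray_from p c t)) -` {..<e}"
    using t by (auto simp: U boundary_nbhd_def ray_from_\<Phi> \<Phi>_in_boundary ray_apply)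
  ultimately show "openin (top_of_set usphere) (\<Phi> -` U \<inter> topspace (top_of_set usphere))" by simp
qed

text \<open>A continuous injection from a compact space into a Hausdorff space is a homeomorphism
  onto its image.\<close>

lemma image_\<Phi>_homeomorphic:
  "subtopology (boundary_topology \<sigma> p) (\<Phi> ` usphere) homeomorphic_space unit_sphere n"
proof -
  let ?T = "subtopology (boundary_topology \<sigma> p) (\<Phi> ` usphere)"
  have sub: "\<Phi> ` usphere \<subseteq> boundary \<sigma>" using \<Phi>_in_boundary by blast
  have "Hausdorff_space ?T"
  proof (rule Hausdorff_space_subtopology_boundary[OF sub])
    fix c c' assume "c \<in> \<Phi> ` usphere" "c' \<in> \<Phi> ` usphere"
      and eq: "\<And>t. 0 \<le> t \<Longrightarrow> ray_from p c t = ray_from p c' t"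
    then obtain u v where uv: "u \<in> usphere" "v \<in> usphere" "c = \<Phi> u" "c' = \<Phi> v" by blast
    have "ray (\<lambda>i. u i / N u) = ray (\<lambda>i. v i / N v)"
    proof
      fix t
      show "ray (\<lambda>i. u i / N u) t = ray (\<lambda>i. v i / N v) t"
        using eq[of t] uv by (cases "0 \<le> t") (auto simp: ray_from_\<Phi> ray_def)
    qed
    then show "c = c'" by (simp add: uv \<Phi>_def)
  qed
  moreover have "compact_space (top_of_set usphere)"
    using compact_unit_sphere[of n] by (simp add: compact_space_subtopology compactin_euclidean_iff)
  moreover have "continuous_map (top_of_set usphere) ?T \<Phi>"
    using continuous_map_\<Phi> by (auto simp: continuous_map_in_subtopology)
  moreover have "\<Phi> ` topspace (top_of_set usphere) = topspace ?T"
    using sub by (auto simp: topspace_boundary_topology)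
  moreover have "inj_on \<Phi> (topspace (top_of_set usphere))" using inj_on_\<Phi> by simp
  ultimately have "homeomorphic_map (top_of_set usphere) ?T \<Phi>"
    by (intro continuous_imp_homeomorphic_map)
  then show ?thesis
    unfolding unit_sphere_eq_top_of_set
    using homeomorphic_map_imp_homeomorphic_space homeomorphic_space_sym by blast
qed

text \<open>Orbit points \<open>Y (a m)\<close> close to \<open>\<zeta> m\<close> have bounded
  directions \<open>a m / m\<close>, which converge to some \<open>x\<close> along a filter
  \<open>F'\<close> finer than \<open>F\<close>. The limits \<open>R\<close> persist along
  \<open>F'\<close>, so each \<open>\<zeta>\<close> may have its own refinement although
  \<open>R\<close> is fixed.\<close>

lemma ray_in_image_\<Phi>:
  assumes cobounded: "\<And>z. \<exists>k. dist z (Y k) \<le> D" and \<zeta>: "\<zeta> \<in> sigma_rays \<sigma>"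
  shows "asymptotic \<sigma> `` {\<zeta>} \<in> \<Phi> ` usphere"
proof -
  have iso: "dist (\<zeta> s) (\<zeta> t) = \<bar>s - t\<bar>" if "0 \<le> s" "0 \<le> t" for s t
    using \<zeta> that by (simp add: sigma_rays_def)
  have "\<forall>m :: nat. \<exists>k. dist (\<zeta> m) (Y k) \<le> D" using cobounded by blast
  then obtain a :: "nat \<Rightarrow> nat \<Rightarrow> int" where a: "\<And>m :: nat. dist (\<zeta> m) (Y (a m)) \<le> D" by metis
  define b where "b = D + dist p (Y (\<lambda>_. 0)) + dist (\<zeta> 0) p"
  have qa: "\<bar>q (a m) - real m\<bar> \<le> b" for m
  proof -
    have "dist p (Y (a m)) \<le> dist p (\<zeta> 0) + real m + D"
      using a[of m] iso[of 0 m] dist_triangle[of p "Y (a m)" "\<zeta> 0"]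
        dist_triangle[of "\<zeta> 0" "Y (a m)" "\<zeta> m"] by simp
    moreover have "real m \<le> dist p (Y (a m)) + dist p (\<zeta> 0) + D"
      using a[of m] iso[of 0 m] dist_triangle[of "\<zeta> 0" "\<zeta> m" p]
        dist_triangle[of p "\<zeta> m" "Y (a m)"] by (simp add: dist_commute)
    ultimately show ?thesis
      using dist_p_Y[of "a m"] unfolding b_def by (simp add: dist_commute)
  qed
  have b0: "0 \<le> b" using qa[of 0] by linarith
  \<comment> \<open>Truncation makes the limit \<open>x\<close> vanish from index \<open>n\<close>
    on, as membership in \<open>usphere\<close> demands.\<close>
  define v where "v = (\<lambda>(m::nat) i. if i < n then of_int (a m i) / real m else 0)"
  have Nv: "N (v m) = q (a m) / real m" for m
  proof -
    have "N (v m) = N (\<lambda>i. 1 / real m * of_int (a m i))"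
      by (rule N_cong) (simp add: v_def)
    also have "\<dots> = 1 / real m * q (a m)" by (subst N_scale) (simp_all only: N_of_int, simp)
    finally show ?thesis by simp
  qed
  have Nv1: "(\<lambda>m. N (v m)) \<longlonglongrightarrow> 1"
  proof (rule Lim_transform_eventually)
    have "(\<lambda>m. (q (a m) - real m) / real m) \<longlonglongrightarrow> 0"
      by (rule Lim_null_comparison[OF _ lim_const_over_n[of b]])
         (auto intro!: always_eventually divide_right_mono qa)
    then show "(\<lambda>m. 1 + (q (a m) - real m) / real m) \<longlonglongrightarrow> 1"
      using tendsto_add[OF tendsto_const[of "1::real"]] by fastforce
    show "\<forall>\<^sub>F m in sequentially. 1 + (q (a m) - real m) / real m = N (v m)"
      by (rule eventually_sequentiallyI[of 1]) (simp add: Nv field_simps)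
  qed
  have Nv_le: "N (v m) \<le> 1 + b" for m
  proof (cases "m = 0")
    case False
    then have m: "1 \<le> real m" by linarith
    have "q (a m) \<le> real m + b" using qa[of m] by linarith
    also have "\<dots> \<le> real m * (1 + b)" using mult_right_mono[OF m b0] by (simp add: distrib_left)
    finally show ?thesis using m by (simp add: Nv field_simps)
  qed (simp add: Nv b0)
  obtain B where B: "0 \<le> B" "\<And>x i. i < n \<Longrightarrow> \<bar>x i\<bar> \<le> B * N x" using coordinate_le_N by blast
  have vb: "v m i \<in> {- (B * (1 + b)) .. B * (1 + b)}" for m i
  proof (cases "i < n")
    case True
    then have "\<bar>v m i\<bar> \<le> B * N (v m)" by (rule B)
    also have "\<dots> \<le> B * (1 + b)" using B Nv_le by (intro mult_left_mono)
    finally show ?thesis by (simp add: abs_le_iff)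
  next
    case False
    then show ?thesis using B b0 by (simp add: v_def)
  qed
  obtain F' x where F': "F' \<noteq> bot" "F' \<le> F" and x: "\<And>i. ((\<lambda>m. v m i) \<longlongrightarrow> x i) F'"
    using pointwise_limit_along_filter[of F "\<lambda>_. {- (B * (1 + b)) .. B * (1 + b)}" v] F_nontrivial vb
    by (metis compact_Icc)
  have F'_seq: "F' \<le> sequentially" using F' F_le by simp
  have Nx: "N x = 1"
    by (rule tendsto_unique[OF F'(1) N_tendsto[of v x F'] tendsto_mono[OF F'_seq Nv1]]) (rule x)
  \<comment> \<open>The intermediate point is \<open>\<sigma> p (\<zeta> m) (t / m)\<close>. Its
    distance to \<open>pt m x t\<close> tends to 0, because the far endpoints differ by
    \<open>o(m)\<close>; its distance to \<open>\<zeta> t\<close> comes from moving the origin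
    alone.\<close>
  have close: "dist (R x t) (\<zeta> t) \<le> dist p (\<zeta> 0)" if t: "0 \<le> t" for t
  proof (rule tendsto_le[OF F'(1)])
    let ?g = "\<lambda>m. dist p (\<zeta> 0) + t * (lip * l1 (\<lambda>i. x i - v m i)) + t * (lip * n + D) / real m"
    have "((\<lambda>m. t * (lip * n + D) / real m) \<longlongrightarrow> 0) F'"
      by (rule tendsto_mono[OF F'_seq lim_const_over_n])
    then have "(?g \<longlongrightarrow> dist p (\<zeta> 0) + t * (lip * l1 (\<lambda>i. x i - x i)) + 0) F'"
      by (intro tendsto_intros x)
    then show "(?g \<longlongrightarrow> dist p (\<zeta> 0)) F'" by simp
    show "((\<lambda>m. dist (pt m x t) (\<zeta> t)) \<longlongrightarrow> dist (R x t) (\<zeta> t)) F'"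
      by (intro tendsto_intros tendsto_mono[OF F'(2) R])
    show "\<forall>\<^sub>F m in F'. dist (pt m x t) (\<zeta> t) \<le> ?g m"
      using filter_leD[OF F'(2) eventually_large[of t]]
    proof eventually_elim
      case (elim m)
      then have m: "t \<le> real m" "0 < real m" by auto
      have tm: "t / real m \<in> {0..1}" using t m by simp
      have "dist (Y (floor_vec m x)) (Y (a m)) \<le> lip * (\<Sum>i<n. \<bar>of_int (floor_vec m x i) - of_int (a m i)\<bar>)"
        unfolding dist_Y by (rule q_diff_le_real)
      also have "\<dots> \<le> lip * (\<Sum>i<n. real m * \<bar>x i - v m i\<bar> + 1)"
      proof (intro mult_left_mono sum_mono lip_nonneg)
        fix i assume "i \<in> {..<n}"
        then have "real m * v m i = of_int (a m i)" using m by (simp add: v_def)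
        then show "\<bar>real_of_int (floor_vec m x i) - of_int (a m i)\<bar> \<le> real m * \<bar>x i - v m i\<bar> + 1"
          using floor_vec_diff_le[of m x i "v m i"] by simp
      qed
      also have "\<dots> = real m * (lip * l1 (\<lambda>i. x i - v m i)) + lip * n"
        by (simp add: sum.distrib sum_distrib_left algebra_simps)
      finally have "dist (Y (floor_vec m x)) (\<zeta> m) \<le> real m * (lip * l1 (\<lambda>i. x i - v m i)) + (lip * n + D)"
        using a[of m] dist_triangle[of "Y (floor_vec m x)" "\<zeta> m" "Y (a m)"] by (simp add: dist_commute)
      then have "t / real m * dist (Y (floor_vec m x)) (\<zeta> m)
          \<le> t / real m * (real m * (lip * l1 (\<lambda>i. x i - v m i)) + (lip * n + D))"
        using t by (intro mult_left_mono) auto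
      also have "\<dots> = t * (lip * l1 (\<lambda>i. x i - v m i)) + t * (lip * n + D) / real m"
        using m by (simp add: field_simps)
      finally have 1: "dist (pt m x t) (\<sigma> p (\<zeta> m) (t / real m))
          \<le> t * (lip * l1 (\<lambda>i. x i - v m i)) + t * (lip * n + D) / real m"
        using pt_dist_le[of t m x "\<zeta> m"] t m by simp
      have "dist (\<sigma> p (\<zeta> m) (t / real m)) (\<zeta> t) \<le> (1 - t / real m) * dist p (\<zeta> 0)"
        using conicalD[OF conical tm, of p "\<zeta> m" "\<zeta> 0" "\<zeta> m"] sigma_ray_eq[OF bicombing \<zeta> t m] by simp
      also have "\<dots> \<le> dist p (\<zeta> 0)" using tm by (intro mult_left_le_one_le) auto
      finally show ?case
        using 1 dist_triangle[of "pt m x t" "\<zeta> t" "\<sigma> p (\<zeta> m) (t / real m)"] by linarith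
    qed
  qed
  have "(\<zeta>, ray x) \<in> asymptotic \<sigma>"
    using close \<zeta> ray_in_sigma_rays[OF Nx]
    unfolding asymptotic_def by (auto simp: ray_apply dist_commute intro!: bdd_aboveI[of _ "dist p (\<zeta> 0)"])
  then have cls: "asymptotic \<sigma> `` {\<zeta>} = asymptotic \<sigma> `` {ray x}"
    by (rule equiv_class_eq[OF equiv_asymptotic])
  have x0: "x i = 0" if "\<not> i < n" for i
  proof -
    have "((\<lambda>m. 0) \<longlongrightarrow> x i) F'" using x[of i] that by (simp add: v_def)
    then show ?thesis using tendsto_unique[OF F'(1) _ tendsto_const] by blast
  qed
  \<comment> \<open>Dividing by the Euclidean length gives the point \<open>u\<close> of the sphere;
    since \<open>N x = 1\<close>, normalizing \<open>u\<close> by \<open>N\<close> returns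
    \<open>x\<close>.\<close>
  define r where "r = sqrt (\<Sum>i<n. x i ^ 2)"
  have r2: "r ^ 2 = (\<Sum>i<n. x i ^ 2)" unfolding r_def by (simp add: sum_nonneg)
  have "r \<noteq> 0"
  proof
    assume "r = 0"
    then have "(\<Sum>i<n. x i ^ 2) = 0" using r2 by simp
    then have "N x = N (\<lambda>i. of_int 0)" by (intro N_cong) (simp add: sum_nonneg_eq_0_iff)
    then show False using Nx N_of_int[of "\<lambda>i. 0"] by (simp add: q_zero)
  qed
  moreover have "0 \<le> r" by (simp add: r_def sum_nonneg)
  ultimately have r: "0 < r" by simp
  define u where "u = (\<lambda>i. x i / r)"
  have "(\<Sum>i<n. u i ^ 2) = 1"
    using r by (simp add: u_def power_divide flip: sum_divide_distrib r2)
  then have "u \<in> usphere" using x0 by (simp add: u_def)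
  moreover have "(\<lambda>i. u i / N u) = x"
  proof -
    have "N u = 1 / r" using N_scale[of "1 / r" x] r Nx by (simp add: u_def)
    then show ?thesis using r by (simp add: u_def)
  qed
  ultimately show ?thesis using cls by (auto simp: \<Phi>_def intro!: image_eqI[of _ _ u])
qed

end

section \<open>Existence of limit rays and the resulting spheres\<close>

context normed_orbit
begin

lemma limit_exists: "\<exists>F R. normed_orbit_limit n q \<sigma> Y p F R"
proof -
  \<comment> \<open>Vector and time form one index, so a single compactness argument yields all
    limits.\<close>
  define f where "f = (\<lambda>m (x, t). pt m x t)"
  define K where "K = (\<lambda>(x, t). cball p (\<bar>t\<bar> * (N x + err)))"
  have 1: "compact (K z)" for z by (auto simp: K_def proper split: prod.split)
  have 2: "f m z \<in> K z" for m z
    using pt_bounded by (auto simp: f_def K_def split: prod.split)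
  obtain F R where "F \<noteq> bot" "F \<le> sequentially" and R: "\<And>z. ((\<lambda>m. f m z) \<longlongrightarrow> R z) F"
    using pointwise_limit_along_filter[of sequentially K f, OF sequentially_bot 1 2] by blast
  then have "normed_orbit_limit n q \<sigma> Y p F (\<lambda>x t. R (x, t))"
    by unfold_locales (use R in \<open>auto simp: f_def\<close>)
  then show ?thesis by blast
qed

theorem boundary_contains_sphere:
  "\<exists>S. S \<subseteq> boundary \<sigma> \<and> subtopology (boundary_topology \<sigma> p) S homeomorphic_space unit_sphere n"
proof -
  obtain F R where "normed_orbit_limit n q \<sigma> Y p F R" using limit_exists by blast
  then interpret normed_orbit_limit n q \<sigma> Y p F R .
  show ?thesis using image_\<Phi>_homeomorphic \<Phi>_in_boundary by blast
qed

theorem boundary_homeomorphic_sphere: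
  assumes "\<And>z. \<exists>k. dist z (Y k) \<le> D"
  shows "boundary_topology \<sigma> p homeomorphic_space unit_sphere n"
proof -
  obtain F R where "normed_orbit_limit n q \<sigma> Y p F R" using limit_exists by blast
  then interpret normed_orbit_limit n q \<sigma> Y p F R .
  have "boundary \<sigma> \<subseteq> \<Phi> ` usphere"
    unfolding boundary_def using ray_in_image_\<Phi>[OF assms] by (auto elim!: quotientE)
  then have "\<Phi> ` usphere = topspace (boundary_topology \<sigma> p)"
    using \<Phi>_in_boundary by (auto simp: topspace_boundary_topology)
  then show ?thesis using image_\<Phi>_homeomorphic by simp
qed

end

section \<open>Simultaneously minimal displacement\<close>

locale equivariant_geometric_action = group G for G :: "('b, 'm) monoid_scheme" (structure) +
  fixes \<phi> :: "'b \<Rightarrow> 'c \<Rightarrow> 'c::metric_space" and \<sigma> :: "'c \<Rightarrow> 'c \<Rightarrow> real \<Rightarrow> 'c"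
  assumes geometric: "geometric_action G \<phi>"
    and proper: "compact (cball (x::'c) r)"
    and bicombing: "bicombing \<sigma>"
    and conical: "conical \<sigma>"
    and reversible: "reversible \<sigma>"
    and equivariant: "equivariant G \<phi> \<sigma>"
begin

lemma action: "group_action G UNIV \<phi>"
  using geometric by (simp add: geometric_action_def)

lemma act_mult: "g \<in> carrier G \<Longrightarrow> h \<in> carrier G \<Longrightarrow> \<phi> (g \<otimes> h) x = \<phi> g (\<phi> h x)"
  using group_action.composition_rule[OF action, of x g h] by simp

lemma act_one: "\<phi> \<one> x = x"
  using group_action.id_eq_one[OF action] by (metis UNIV_I restrict_apply)

lemma act_inv: "g \<in> carrier G \<Longrightarrow> \<phi> (inv g) (\<phi> g x) = x"
  by (simp add: act_one flip: act_mult)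

lemma act_dist: "g \<in> carrier G \<Longrightarrow> dist (\<phi> g x) (\<phi> g y) = dist x y"
  using geometric by (simp add: geometric_action_def)

lemma finite_return_set: "finite {g \<in> carrier G. dist x (\<phi> g y) \<le> r}"
proof -
  \<comment> \<open>The radius is large enough for the ball to contain both \<open>y\<close> and
    \<open>\<phi> g y\<close>.\<close>
  let ?K = "cball x (max r (dist x y))"
  have "finite {g \<in> carrier G. \<phi> g ` ?K \<inter> ?K \<noteq> {}}"
    using geometric proper by (simp add: geometric_action_def)
  moreover have "{g \<in> carrier G. dist x (\<phi> g y) \<le> r} \<subseteq> {g \<in> carrier G. \<phi> g ` ?K \<inter> ?K \<noteq> {}}"
  proof
    fix g assume g: "g \<in> {g \<in> carrier G. dist x (\<phi> g y) \<le> r}"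
    then have "\<phi> g y \<in> \<phi> g ` ?K \<inter> ?K" by auto
    with g show "g \<in> {g \<in> carrier G. \<phi> g ` ?K \<inter> ?K \<noteq> {}}" by blast
  qed
  ultimately show ?thesis by (rule finite_subset[rotated])
qed

text \<open>The sets \<open>W j\<close> of points with a translate in the open ball of radius
  \<open>j\<close> about \<open>z\<close> are open and invariant, so their images form an open cover
  of the compact orbit space.\<close>

lemma cobounded: "\<exists>r. \<forall>x. \<exists>g\<in>carrier G. dist (\<phi> g x) z \<le> r"
proof -
  define W where "W = (\<lambda>j::nat. {x. \<exists>g\<in>carrier G. dist (\<phi> g x) z < j})"
  define U where "U = (\<lambda>j. orbit G \<phi> ` W j)"
  have W: "x \<in> W j" if x: "orbit G \<phi> x \<in> U j" for x j
  proof -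
    obtain x' where x': "x' \<in> W j" "orbit G \<phi> x = orbit G \<phi> x'" using x by (auto simp: U_def)
    have "x' \<in> orbit G \<phi> x'" using group_action.orbit_refl[OF action] by simp
    then obtain h where h: "h \<in> carrier G" "x' = \<phi> h x" using x'(2) by (auto simp: orbit_def)
    obtain g where g: "g \<in> carrier G" "dist (\<phi> g x') z < j" using x'(1) by (auto simp: W_def)
    then have "dist (\<phi> (g \<otimes> h) x) z < j" using h by (simp add: act_mult)
    then show ?thesis using g h by (auto simp: W_def)
  qed
  have "open (W j)" for j
  proof (rule openI)
    fix x assume "x \<in> W j"
    then obtain g where g: "g \<in> carrier G" "dist (\<phi> g x) z < j" by (auto simp: W_def)
    have "ball x (j - dist (\<phi> g x) z) \<subseteq> W j"
    proof
      fix x' assume "x' \<in> ball x (j - dist (\<phi> g x) z)"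
      then have "dist (\<phi> g x') z < j"
        using dist_triangle[of "\<phi> g x'" z "\<phi> g x"] act_dist[OF g(1), of x' x] by (simp add: dist_commute)
      then show "x' \<in> W j" using g by (auto simp: W_def)
    qed
    then show "\<exists>e>0. ball x e \<subseteq> W j" using g by (intro exI[of _ "j - dist (\<phi> g x) z"]) auto
  qed
  moreover have "{x. orbit G \<phi> x \<in> U j} = W j" for j
    using W[of _ j] imageI[of _ "W j" "orbit G \<phi>"] unfolding U_def by blast
  moreover have "U j \<subseteq> orbits G UNIV \<phi>" for j unfolding U_def orbits_def by blast
  ultimately have U: "openin (orbit_topology G \<phi>) (U j)" for j
    by (simp only: openin_orbit_topology)
  have top: "topspace (orbit_topology G \<phi>) = range (orbit G \<phi>)"
    using quotient_imp_surjective_map[OF quotient_map_orbit, of G \<phi>] by simp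
  have cover: "topspace (orbit_topology G \<phi>) \<subseteq> \<Union> (range U)"
  proof
    fix c assume "c \<in> topspace (orbit_topology G \<phi>)"
    then obtain x where x: "c = orbit G \<phi> x" using top by auto
    obtain j :: nat where "dist (\<phi> \<one> x) z < j" using reals_Archimedean2 by blast
    then have "x \<in> W j" by (auto simp: W_def)
    then show "c \<in> \<Union> (range U)" using x by (auto simp: U_def)
  qed
  have cpt: "compactin (orbit_topology G \<phi>) (topspace (orbit_topology G \<phi>))"
    using geometric by (simp add: geometric_action_def compact_space_def)
  have "openin (orbit_topology G \<phi>) V" if "V \<in> range U" for V using that U by auto
  from compactinD[OF cpt this cover] obtain \<F> where \<F>: "finite \<F>" "\<F> \<subseteq> range U" "topspace (orbit_topology G \<phi>) \<subseteq> \<Union>\<F>"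
    by blast
  then obtain J where J: "finite J" "\<F> = U ` J" using finite_subset_image[of \<F> U UNIV] by auto
  have "\<exists>g\<in>carrier G. dist (\<phi> g x) z \<le> Max (insert 0 J)" for x
  proof -
    have "orbit G \<phi> x \<in> \<Union>\<F>" using \<F>(3) top by blast
    then obtain j where j: "j \<in> J" "orbit G \<phi> x \<in> U j" using J by auto
    from W[OF j(2)] obtain g where g: "g \<in> carrier G" "dist (\<phi> g x) z < j" by (auto simp: W_def)
    have "j \<le> Max (insert 0 J)" using J j by simp
    then have "real j \<le> real (Max (insert 0 J))" by simp
    with g(2) have "dist (\<phi> g x) z \<le> real (Max (insert 0 J))" by linarith
    with g(1) show ?thesis by blast
  qed
  then show ?thesis by blast
qed

section \<open>Displacement and translation length\<close>

definition displ :: "'b \<Rightarrow> 'c \<Rightarrow> real" where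
  "displ g x = dist x (\<phi> g x)"

definition transl_len :: "'b \<Rightarrow> real" where
  "transl_len g = (INF x. displ g x)"

lemma transl_len_le: "transl_len g \<le> displ g x"
  unfolding transl_len_def by (rule cINF_lower[OF bdd_belowI2[of _ 0]]) (auto simp: displ_def)

lemma transl_len_approx:
  assumes "0 < e"
  obtains z where "displ g z < transl_len g + e"
proof -
  have "Inf (range (displ g)) < transl_len g + e" using assms by (simp add: transl_len_def)
  then show ?thesis using cInf_lessD[of "range (displ g)" "transl_len g + e"] that by auto
qed

lemma displ_mult_le:
  assumes "g \<in> carrier G" "h \<in> carrier G"
  shows "displ (g \<otimes> h) x \<le> displ g x + displ h x"
  using dist_triangle[of x "\<phi> g (\<phi> h x)" "\<phi> g x"] assms
  by (simp add: displ_def act_mult act_dist)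

lemma displ_pow_le:
  assumes "g \<in> carrier G"
  shows "displ (g [^] (j::nat)) x \<le> real j * displ g x"
proof (induction j)
  case (Suc j)
  have "displ (g [^] Suc j) x \<le> displ (g [^] j) x + displ g x"
    using displ_mult_le[of "g [^] j" g x] assms by simp
  with Suc show ?case by (simp add: algebra_simps)
qed (simp add: displ_def act_one)

lemma displ_le_add_dist:
  assumes "g \<in> carrier G"
  shows "displ g x \<le> displ g z + 2 * dist x z"
  using dist_triangle[of x "\<phi> g x" z] dist_triangle[of z "\<phi> g x" "\<phi> g z"] act_dist[OF assms, of z x]
  by (simp add: displ_def dist_commute)

lemma displ_conj:
  assumes "g \<in> carrier G" "h \<in> carrier G"
  shows "displ (h \<otimes> g \<otimes> inv h) (\<phi> h x) = displ g x"
  using assms by (simp add: displ_def act_mult act_inv act_dist)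

lemma displ_commuting:
  assumes "g \<in> carrier G" "h \<in> carrier G" "g \<otimes> h = h \<otimes> g"
  shows "displ g (\<phi> h x) = displ g x"
  using assms act_dist[of h x "\<phi> g x"] unfolding displ_def by (metis act_mult)

lemma equivariantD: "g \<in> carrier G \<Longrightarrow> t \<in> {0..1} \<Longrightarrow> \<phi> g (\<sigma> x y t) = \<sigma> (\<phi> g x) (\<phi> g y) t"
  using equivariant by (simp add: equivariant_def)

text \<open>By reversibility the midpoint and its translate are midpoints of geodesics that both
  start at \<open>\<phi> g x\<close> and end at \<open>x\<close> and
  \<open>\<phi> g (\<phi> g x)\<close>; conicality halves the distance of these ends.\<close>

lemma displ_midpoint:
  assumes g: "g \<in> carrier G"
  shows "displ g (\<sigma> x (\<phi> g x) (1/2)) \<le> displ (g \<otimes> g) x / 2"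
proof -
  have "\<sigma> x (\<phi> g x) (1/2) = \<sigma> (\<phi> g x) x (1/2)"
    using reversible[unfolded reversible_def, rule_format, of "1/2" x "\<phi> g x"] by simp
  then have "displ g (\<sigma> x (\<phi> g x) (1/2))
      = dist (\<sigma> (\<phi> g x) x (1/2)) (\<phi> g (\<sigma> x (\<phi> g x) (1/2)))"
    by (simp add: displ_def)
  also have "\<phi> g (\<sigma> x (\<phi> g x) (1/2)) = \<sigma> (\<phi> g x) (\<phi> g (\<phi> g x)) (1/2)"
    using g by (simp add: equivariantD)
  also have "dist (\<sigma> (\<phi> g x) x (1/2)) (\<sigma> (\<phi> g x) (\<phi> g (\<phi> g x)) (1/2)) \<le> dist x (\<phi> g (\<phi> g x)) / 2"
    using conicalD[OF conical, of "1/2" "\<phi> g x" x "\<phi> g x" "\<phi> g (\<phi> g x)"] by simp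
  finally show ?thesis using g by (simp add: displ_def act_mult)
qed

text \<open>Conicality bounds the displacement at the midpoint by the mean of the displacements at
  the ends, which agree because \<open>g\<close> commutes with \<open>h\<close>.\<close>

lemma displ_midpoint_commuting:
  assumes "g \<in> carrier G" "h \<in> carrier G" "g \<otimes> h = h \<otimes> g"
  shows "displ h (\<sigma> x (\<phi> g x) (1/2)) \<le> displ h x"
proof -
  have "displ h (\<sigma> x (\<phi> g x) (1/2)) \<le> displ h x / 2 + displ h (\<phi> g x) / 2"
    using conicalD[OF conical, of "1/2" x "\<phi> g x" "\<phi> h x" "\<phi> h (\<phi> g x)"] assms
    by (simp add: displ_def equivariantD)
  then show ?thesis using displ_commuting[of h g x] assms by simp
qed

lemma transl_len_square:
  assumes g: "g \<in> carrier G"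
  shows "transl_len (g \<otimes> g) = 2 * transl_len g"
proof (rule antisym)
  show "2 * transl_len g \<le> transl_len (g \<otimes> g)"
  proof (rule field_le_epsilon)
    fix e :: real assume "0 < e"
    then obtain z where "displ (g \<otimes> g) z < transl_len (g \<otimes> g) + e" by (rule transl_len_approx)
    then show "2 * transl_len g \<le> transl_len (g \<otimes> g) + e"
      using displ_midpoint[OF g, of z] transl_len_le[of g "\<sigma> z (\<phi> g z) (1/2)"] by simp
  qed
  show "transl_len (g \<otimes> g) \<le> 2 * transl_len g"
  proof (rule field_le_epsilon)
    fix e :: real assume "0 < e"
    then obtain z where "displ g z < transl_len g + e / 2" using transl_len_approx[of "e / 2" g] by auto
    then show "transl_len (g \<otimes> g) \<le> 2 * transl_len g + e"
      using displ_mult_le[OF g g, of z] transl_len_le[of "g \<otimes> g" z] by simp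
  qed
qed

text \<open>Midpoints are taken for the \<open>2 ^ (j - 1)\<close>-th power of \<open>g\<close>
  first and for \<open>g\<close> last. What commutes with \<open>g\<close> commutes with its powers,
  so no step increases its displacement. The induction hypothesis is used at
  \<open>g \<otimes> g\<close>.\<close>

lemma displ_iterated_midpoint:
  assumes "g \<in> carrier G"
  shows "\<exists>x'. displ g x' \<le> displ (g [^] (2 ^ j :: nat)) x / 2 ^ j \<and>
    (\<forall>h\<in>carrier G. g \<otimes> h = h \<otimes> g \<longrightarrow> displ h x' \<le> displ h x)"
  using assms
proof (induction j arbitrary: g)
  case 0
  then show ?case by (intro exI[of _ x]) simp
next
  case (Suc j)
  have gg: "g \<otimes> g \<in> carrier G" using Suc.prems by simp
  from Suc.IH[OF gg] obtain x' where
    x': "displ (g \<otimes> g) x' \<le> displ ((g \<otimes> g) [^] (2 ^ j :: nat)) x / 2 ^ j"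
    and comm: "\<And>h. h \<in> carrier G \<Longrightarrow> (g \<otimes> g) \<otimes> h = h \<otimes> (g \<otimes> g) \<Longrightarrow> displ h x' \<le> displ h x"
    by blast
  have pow: "(g \<otimes> g) [^] (2 ^ j :: nat) = g [^] (2 ^ Suc j :: nat)"
    using nat_pow_pow[OF Suc.prems, of 2 "2 ^ j"] Suc.prems by (simp add: numeral_2_eq_2)
  let ?m = "\<sigma> x' (\<phi> g x') (1/2)"
  have "displ g ?m \<le> displ (g [^] (2 ^ Suc j :: nat)) x / 2 ^ Suc j"
    using order_trans[OF displ_midpoint[OF Suc.prems, of x'] divide_right_mono[OF x', of 2]]
    unfolding pow by (simp add: mult.commute)
  moreover have "displ h ?m \<le> displ h x" if h: "h \<in> carrier G" "g \<otimes> h = h \<otimes> g" for h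
  proof -
    have "(g \<otimes> g) \<otimes> h = h \<otimes> (g \<otimes> g)" using h Suc.prems by (metis m_assoc)
    then show ?thesis
      using comm[OF h(1)] displ_midpoint_commuting[OF Suc.prems h, of x'] by simp
  qed
  ultimately show ?case by blast
qed

text \<open>The displacement of a high power at \<open>x\<close> exceeds that at an almost
  minimizing \<open>z\<close> by at most \<open>2 * dist x z\<close>, which is negligible after
  division by \<open>2 ^ j\<close>.\<close>

lemma displ_reduce:
  assumes g: "g \<in> carrier G" and e: "0 < e"
  obtains x' where "displ g x' \<le> transl_len g + e"
    "\<And>h. h \<in> carrier G \<Longrightarrow> g \<otimes> h = h \<otimes> g \<Longrightarrow> displ h x' \<le> displ h x"
proof -
  obtain z where z: "displ g z < transl_len g + e / 2" using transl_len_approx[of "e / 2" g] e by auto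
  obtain j :: nat where j: "4 * dist x z / e < 2 ^ j"
    using real_arch_pow[of 2 "4 * dist x z / e"] by auto
  obtain x' where x': "displ g x' \<le> displ (g [^] (2 ^ j :: nat)) x / 2 ^ j"
    "\<And>h. h \<in> carrier G \<Longrightarrow> g \<otimes> h = h \<otimes> g \<Longrightarrow> displ h x' \<le> displ h x"
    using displ_iterated_midpoint[OF g, of j x] by blast
  have "displ (g [^] (2 ^ j :: nat)) x \<le> displ (g [^] (2 ^ j :: nat)) z + 2 * dist x z"
    by (rule displ_le_add_dist) (use g in simp)
  also have "\<dots> \<le> 2 ^ j * displ g z + 2 * dist x z" using displ_pow_le[OF g, of "2 ^ j" z] by simp
  finally have "displ (g [^] (2 ^ j :: nat)) x / 2 ^ j \<le> displ g z + 2 * dist x z / 2 ^ j"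
    by (simp add: field_simps)
  moreover have "2 * dist x z / 2 ^ j < e / 2" using j e by (simp add: field_simps)
  ultimately have "displ g x' \<le> transl_len g + e" using x'(1) z by linarith
  with x'(2) show thesis using that by blast
qed

text \<open>Treating a new element by \<open>displ_reduce\<close> does not spoil the earlier ones,
  since they commute with it.\<close>

lemma displ_simultaneous:
  assumes "finite S" "S \<subseteq> carrier G" "\<And>g h. g \<in> S \<Longrightarrow> h \<in> S \<Longrightarrow> g \<otimes> h = h \<otimes> g" "0 < e"
  shows "\<exists>x. \<forall>g\<in>S. displ g x \<le> transl_len g + e"
  using assms(1-3)
proof (induction S)
  case (insert g S)
  then obtain x where x: "\<And>h. h \<in> S \<Longrightarrow> displ h x \<le> transl_len h + e" by force
  have "g \<in> carrier G" using insert.prems by simp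
  then obtain x' where x': "displ g x' \<le> transl_len g + e"
    "\<And>h. h \<in> carrier G \<Longrightarrow> g \<otimes> h = h \<otimes> g \<Longrightarrow> displ h x' \<le> displ h x"
    using displ_reduce[OF _ assms(4), of g x] by blast
  have "displ h x' \<le> transl_len h + e" if "h \<in> S" for h
    using x[OF that] x'(2)[of h] insert.prems that by (meson insertI1 insertI2 order_trans subset_iff)
  with x'(1) show ?case by blast
qed simp

text \<open>Points that almost minimize the displacement of more and more elements of \<open>A\<close> are moved into
  a compact set by elements \<open>g k\<close> of \<open>G\<close>. By properness infinitely many \<open>g k\<close> conjugate the finite
  set \<open>E\<close> in the same way; their quotients centralize \<open>A\<close> and hence preserve displacements.\<close>

lemma exists_minimal_displacement:
  assumes A: "A \<subseteq> carrier G" "countable A" "A \<noteq> {}"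
    and abelian: "\<And>a b. a \<in> A \<Longrightarrow> b \<in> A \<Longrightarrow> a \<otimes> b = b \<otimes> a"
    and E: "finite E" "E \<subseteq> A"
    and gen: "\<And>h a. h \<in> carrier G \<Longrightarrow> (\<And>b. b \<in> E \<Longrightarrow> h \<otimes> b = b \<otimes> h) \<Longrightarrow> a \<in> A \<Longrightarrow> h \<otimes> a = a \<otimes> h"
  obtains y where "\<And>a. a \<in> A \<Longrightarrow> displ a y = transl_len a"
proof -
  fix z :: 'c
  obtain r where r: "\<And>x. \<exists>g\<in>carrier G. dist (\<phi> g x) z \<le> r" using cobounded by blast
  \<comment> \<open>These finite sets exhaust \<open>A\<close> and always contain \<open>E\<close>,
    whose displacements control the conjugates below.\<close>
  define S where "S = (\<lambda>k. E \<union> from_nat_into A ` {..k::nat})"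
  have SA: "S k \<subseteq> A" for k using E from_nat_into[OF A(3)] by (auto simp: S_def)
  have "\<exists>x. \<forall>g\<in>S k. displ g x \<le> transl_len g + inverse (real (Suc k))" for k
  proof (rule displ_simultaneous)
    show "finite (S k)" using E by (simp add: S_def)
    show "S k \<subseteq> carrier G" using SA A by blast
    show "g \<otimes> h = h \<otimes> g" if "g \<in> S k" "h \<in> S k" for g h using SA abelian that by blast
  qed simp
  then obtain x where x: "\<And>k g. g \<in> S k \<Longrightarrow> displ g (x k) \<le> transl_len g + inverse (real (Suc k))" by metis
  have "\<forall>k. \<exists>g. g \<in> carrier G \<and> dist (\<phi> g (x k)) z \<le> r" using r by blast
  then obtain g where g: "\<And>k. g k \<in> carrier G" "\<And>k. dist (\<phi> (g k) (x k)) z \<le> r" by metis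
  define c where "c = (\<lambda>k. restrict (\<lambda>b. g k \<otimes> b \<otimes> inv (g k)) E)"
  \<comment> \<open>The conjugate of \<open>b\<close> displaces the translate of \<open>x k\<close>
    as \<open>b\<close> displaces \<open>x k\<close>; passing from there to \<open>z\<close> adds at
    most \<open>2 * r\<close>. So only finitely many conjugates occur.\<close>
  have "range c \<subseteq> PiE E (\<lambda>b. {h \<in> carrier G. dist z (\<phi> h z) \<le> transl_len b + 1 + 2 * r})"
  proof (clarsimp simp: c_def)
    fix k b assume b: "b \<in> E"
    then have bG: "b \<in> carrier G" using E A by blast
    have "displ b (x k) \<le> transl_len b + inverse (real (Suc k))" using x b by (simp add: S_def)
    moreover have "inverse (real (Suc k)) \<le> 1" by (simp add: field_simps)
    ultimately have "displ (g k \<otimes> b \<otimes> inv (g k)) (\<phi> (g k) (x k)) \<le> transl_len b + 1"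
      using displ_conj[OF bG g(1)] by simp
    moreover have cG: "g k \<otimes> b \<otimes> inv (g k) \<in> carrier G" using bG g by simp
    ultimately have "displ (g k \<otimes> b \<otimes> inv (g k)) z \<le> transl_len b + 1 + 2 * r"
      using displ_le_add_dist[OF cG, of z "\<phi> (g k) (x k)"] g(2)[of k] by (simp add: dist_commute)
    with cG show "g k \<otimes> b \<otimes> inv (g k) \<in> carrier G \<and>
        dist z (\<phi> (g k \<otimes> b \<otimes> inv (g k)) z) \<le> transl_len b + 1 + 2 * r"
      by (simp add: displ_def)
  qed
  then have "finite (range c)"
    by (rule finite_subset) (intro finite_PiE E finite_return_set)
  then obtain k0 where k0: "infinite {k. c k = c k0}"
    using pigeonhole_infinite[of UNIV c] by auto
  define \<iota> where "\<iota> = enumerate {k. c k = c k0}"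
  have mono: "strict_mono \<iota>" unfolding \<iota>_def by (rule strict_mono_enumerate[OF k0])
  have c\<iota>: "c (\<iota> j) = c k0" for j using enumerate_in_set[OF k0] by (simp add: \<iota>_def)
  define h where "h = (\<lambda>j. inv (g k0) \<otimes> g (\<iota> j))"
  have hG: "h j \<in> carrier G" for j using g by (simp add: h_def)
  have "h j \<otimes> b = b \<otimes> h j" if b: "b \<in> E" for j b
  proof -
    have bG: "b \<in> carrier G" using b E A by blast
    have "g (\<iota> j) \<otimes> b \<otimes> inv (g (\<iota> j)) = g k0 \<otimes> b \<otimes> inv (g k0)"
      using fun_cong[OF c\<iota>[of j], of b] b by (simp add: c_def)
    then have "g (\<iota> j) \<otimes> b = g k0 \<otimes> b \<otimes> inv (g k0) \<otimes> g (\<iota> j)"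
      using bG g by (metis inv_closed inv_solve_right' m_closed)
    then have "inv (g k0) \<otimes> (g (\<iota> j) \<otimes> b) = inv (g k0) \<otimes> (g k0 \<otimes> (b \<otimes> (inv (g k0) \<otimes> g (\<iota> j))))"
      using bG g by (simp add: m_assoc)
    then show ?thesis using bG g by (simp add: h_def m_assoc inv_solve_left')
  qed
  then have comm: "h j \<otimes> a = a \<otimes> h j" if "a \<in> A" for j a using gen[OF hG] that by blast
  \<comment> \<open>\<open>A\<close> displaces \<open>w j\<close> as it displaces
    \<open>x (\<iota> j)\<close>, and \<open>w j\<close> stays in one ball, because it arises from a
    point near \<open>z\<close> by the fixed isometry of \<open>inv (g k0)\<close>.\<close>
  define w where "w = (\<lambda>j. \<phi> (h j) (x (\<iota> j)))"
  have "w j \<in> cball (\<phi> (inv (g k0)) z) r" for j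
    using g(2)[of "\<iota> j"] g(1) act_dist[of "inv (g k0)" z "\<phi> (g (\<iota> j)) (x (\<iota> j))"]
    by (simp add: w_def h_def act_mult dist_commute)
  then obtain y s where s: "strict_mono s" and y: "(w \<circ> s) \<longlonglongrightarrow> y"
    using proper[of "\<phi> (inv (g k0)) z" r] unfolding compact_def by metis
  show thesis
  proof (rule that, rule antisym)
    fix a assume a: "a \<in> A"
    then have aG: "a \<in> carrier G" using A by blast
    show "transl_len a \<le> displ a y" by (rule transl_len_le)
    obtain i where i: "from_nat_into A i = a" using a A by (metis from_nat_into_surj)
    have mono': "strict_mono (\<iota> \<circ> s)" using mono s by (rule strict_mono_o)
    have "(\<lambda>j. dist y ((w \<circ> s) j)) \<longlonglongrightarrow> dist y y"
      by (intro tendsto_intros y)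
    moreover have "(\<lambda>j. inverse (real (Suc ((\<iota> \<circ> s) j)))) \<longlonglongrightarrow> 0"
      using LIMSEQ_subseq_LIMSEQ[OF LIMSEQ_inverse_real_of_nat mono'] by (simp add: o_def)
    ultimately have "(\<lambda>j. transl_len a + inverse (real (Suc ((\<iota> \<circ> s) j))) + 2 * dist y ((w \<circ> s) j))
        \<longlonglongrightarrow> transl_len a + 0 + 2 * dist y y"
      by (intro tendsto_add tendsto_mult tendsto_const)
    then have lim: "(\<lambda>j. transl_len a + inverse (real (Suc ((\<iota> \<circ> s) j))) + 2 * dist y ((w \<circ> s) j)) \<longlonglongrightarrow> transl_len a"
      by simp
    have "displ a y \<le> transl_len a + inverse (real (Suc ((\<iota> \<circ> s) j))) + 2 * dist y ((w \<circ> s) j)" if "i \<le> j" for j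
    proof -
      have "i \<le> (\<iota> \<circ> s) j" using that seq_suble[OF mono', of j] by simp
      then have "a \<in> S ((\<iota> \<circ> s) j)" using i by (auto simp: S_def)
      then have "displ a (x ((\<iota> \<circ> s) j)) \<le> transl_len a + inverse (real (Suc ((\<iota> \<circ> s) j)))" by (rule x)
      moreover have "displ a ((w \<circ> s) j) = displ a (x ((\<iota> \<circ> s) j))"
        using displ_commuting[OF aG hG] comm[OF a] by (simp add: w_def)
      ultimately show ?thesis using displ_le_add_dist[OF aG, of y "(w \<circ> s) j"] by linarith
    qed
    then show "displ a y \<le> transl_len a" by (intro LIMSEQ_le_const[OF lim]) blast
  qed
qed

end

section \<open>Coordinates on the free abelian subgroup, and finite index\<close>

lemma integer_coordinates:
  fixes G :: "('g, 'm) monoid_scheme" (structure)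
  assumes "group G" "subgroup A G"
    and "G\<lparr>carrier := A\<rparr> \<cong> product_group {..<n} (\<lambda>_. integer_group)"
  obtains \<alpha> :: "(nat \<Rightarrow> int) \<Rightarrow> 'g" where
    "\<And>k l. \<alpha> (\<lambda>i. k i + l i) = \<alpha> k \<otimes> \<alpha> l" "range \<alpha> = A" "countable A"
    "\<And>k l. \<alpha> k = \<alpha> l \<longleftrightarrow> (\<forall>i<n. k i = l i)"
proof -
  let ?P = "product_group {..<n} (\<lambda>_. integer_group)" and ?H = "G\<lparr>carrier := A\<rparr>"
  have "group ?H" using assms(1,2) by (rule group.subgroup_imp_group)
  then have "?P \<cong> ?H" using assms(3) by (rule group.iso_sym)
  then obtain h where h: "h \<in> iso ?P ?H" by (auto simp: is_iso_def)
  then have hom: "h (f \<otimes>\<^bsub>?P\<^esub> g) = h f \<otimes> h g" if "f \<in> carrier ?P" "g \<in> carrier ?P" for f g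
    using that by (simp add: iso_def hom_def)
  have bij: "bij_betw h (PiE {..<n} (\<lambda>_. UNIV)) A" using h by (simp add: iso_def)
  \<comment> \<open>Restricting the argument defines the coordinates on all integer sequences, the
    form used in \<open>integer_norm\<close>.\<close>
  define \<alpha> where "\<alpha> = (\<lambda>k. h (restrict k {..<n}))"
  have res: "restrict k {..<n} \<in> PiE {..<n} (\<lambda>_. UNIV)" for k :: "nat \<Rightarrow> int" by auto
  show thesis
  proof (rule that)
    fix k l :: "nat \<Rightarrow> int"
    have "restrict (\<lambda>i. k i + l i) {..<n} = restrict k {..<n} \<otimes>\<^bsub>?P\<^esub> restrict l {..<n}"
      by (auto simp: fun_eq_iff)
    then show "\<alpha> (\<lambda>i. k i + l i) = \<alpha> k \<otimes> \<alpha> l" unfolding \<alpha>_def by (simp only: hom carrier_product_group carrier_integer_group res)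
    have "\<alpha> k = \<alpha> l \<longleftrightarrow> restrict k {..<n} = restrict l {..<n}"
      unfolding \<alpha>_def using bij res by (intro inj_on_eq_iff[OF bij_betw_imp_inj_on])
    also have "\<dots> \<longleftrightarrow> (\<forall>i<n. k i = l i)"
      by (auto simp: fun_eq_iff restrict_def)
    finally show "\<alpha> k = \<alpha> l \<longleftrightarrow> (\<forall>i<n. k i = l i)" .
  next
    show "range \<alpha> = A"
    proof
      show "range \<alpha> \<subseteq> A" unfolding \<alpha>_def using bij res by (auto dest: bij_betwE)
      show "A \<subseteq> range \<alpha>"
      proof
        fix a assume "a \<in> A"
        then obtain f where f: "f \<in> PiE {..<n} (\<lambda>_. UNIV)" "a = h f"
          using bij by (auto simp: bij_betw_def)
        then have "a = \<alpha> f" unfolding \<alpha>_def by (simp add: PiE_restrict)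
        then show "a \<in> range \<alpha>" by blast
      qed
    qed
    have "countable (PiE {..<n} (\<lambda>_. UNIV :: int set))" by (rule countable_PiE) auto
    then show "countable A" using bij by (metis bij_betw_def countable_image)
  qed
qed

lemma (in group) commutes_inv:
  assumes "h \<in> carrier G" "a \<in> carrier G" "h \<otimes> a = a \<otimes> h"
  shows "h \<otimes> inv a = inv a \<otimes> h"
  using assms by (metis inv_closed inv_solve_left' inv_solve_right m_assoc m_closed)

text \<open>The vectors whose images commute with \<open>h\<close> are closed under integer
  combinations, so the basis vectors suffice.\<close>

lemma (in group) commutes_integer_coordinates:
  fixes \<alpha> :: "(nat \<Rightarrow> int) \<Rightarrow> 'a"
  assumes \<alpha>: "\<And>k. \<alpha> k \<in> carrier G" "\<And>k l. \<alpha> (\<lambda>i. k i + l i) = \<alpha> k \<otimes> \<alpha> l"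
    and cong: "\<And>k l. (\<forall>i<n. k i = l i) \<Longrightarrow> \<alpha> k = \<alpha> l"
    and h: "h \<in> carrier G"
    and gen: "\<And>j. j < n \<Longrightarrow> h \<otimes> \<alpha> (\<lambda>i. of_bool (i = j)) = \<alpha> (\<lambda>i. of_bool (i = j)) \<otimes> h"
  shows "h \<otimes> \<alpha> k = \<alpha> k \<otimes> h"
proof -
  define C where "C = {k. h \<otimes> \<alpha> k = \<alpha> k \<otimes> h}"
  have zero: "\<alpha> (\<lambda>i. 0) = \<one>"
    using \<alpha>(2)[of "\<lambda>i. 0" "\<lambda>i. 0"] \<alpha>(1)[of "\<lambda>i. 0"] by (simp add: r_cancel_one')
  have add: "(\<lambda>i. k i + l i) \<in> C" if "k \<in> C" "l \<in> C" for k l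
    using that \<alpha> h unfolding C_def by (simp add: \<alpha>(2)) (metis m_assoc)
  have minus: "(\<lambda>i. - k i) \<in> C" if "k \<in> C" for k
  proof -
    have "\<alpha> (\<lambda>i. - k i) \<otimes> \<alpha> k = \<one>" using \<alpha>(2)[of "\<lambda>i. - k i" k] zero by simp
    then have "\<alpha> (\<lambda>i. - k i) = inv (\<alpha> k)" using \<alpha>(1) by (metis inv_equality)
    then show ?thesis using that commutes_inv[OF h \<alpha>(1), of k] by (simp add: C_def)
  qed
  have zC: "(\<lambda>i. 0) \<in> C" using h by (simp add: C_def zero)
  have nat: "(\<lambda>i. int m * k i) \<in> C" if "k \<in> C" for m k
  proof (induction m)
    case (Suc m)
    then show ?case using add[OF that Suc] by (simp add: algebra_simps)
  qed (simp add: zC)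
  have int: "(\<lambda>i. c * k i) \<in> C" if "k \<in> C" for c k
  proof (cases "0 \<le> c")
    case True
    then show ?thesis using nat[OF that, of "nat c"] by simp
  next
    case False
    then show ?thesis using minus[OF nat[OF that, of "nat (- c)"]] by simp
  qed
  have "(\<lambda>i. if i < m then k i else 0) \<in> C" if "m \<le> n" for m
    using that
  proof (induction m)
    case (Suc m)
    have "(\<lambda>i. k m * of_bool (i = m)) \<in> C" using int gen Suc.prems by (simp add: C_def)
    from add[OF Suc.IH this] Suc.prems
    have "(\<lambda>i. (if i < m then k i else 0) + k m * of_bool (i = m)) \<in> C" by simp
    also have "(\<lambda>i. (if i < m then k i else 0) + k m * of_bool (i = m)) = (\<lambda>i. if i < Suc m then k i else 0)"
      by (auto simp: fun_eq_iff less_Suc_eq)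
    finally show ?case .
  qed (simp add: zC)
  from this[of n] have "(\<lambda>i. if i < n then k i else 0) \<in> C" by simp
  moreover have "\<alpha> (\<lambda>i. if i < n then k i else 0) = \<alpha> k" by (rule cong) simp
  ultimately show ?thesis by (simp add: C_def)
qed

text \<open>If \<open>\<phi> g x\<close> is near \<open>y\<close>, then \<open>x\<close> is near
  \<open>\<phi> (inv g) y\<close>. As these are right cosets, \<open>inv g\<close> is
  \<open>a \<otimes> b\<close> with \<open>a\<close> in \<open>A\<close> and \<open>b\<close> one of
  finitely many representatives, which move \<open>y\<close> boundedly.\<close>

lemma (in equivariant_geometric_action) cobounded_finite_index:
  assumes "subgroup A G" "finite (rcosets A)"
  shows "\<exists>D. \<forall>x. \<exists>a\<in>A. dist x (\<phi> a y) \<le> D"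
proof -
  obtain r where r: "\<And>x. \<exists>g\<in>carrier G. dist (\<phi> g x) y \<le> r" using cobounded by blast
  have "\<forall>c\<in>rcosets A. \<exists>b. b \<in> carrier G \<and> c = A #> b" by (auto simp: RCOSETS_def)
  then obtain b where b: "\<And>c. c \<in> rcosets A \<Longrightarrow> b c \<in> carrier G \<and> c = A #> b c" by metis
  define M where "M = Max (insert 0 ((\<lambda>c. dist (\<phi> (b c) y) y) ` (rcosets A)))"
  have "\<exists>a\<in>A. dist x (\<phi> a y) \<le> r + M" for x
  proof -
    obtain g where g: "g \<in> carrier G" "dist (\<phi> g x) y \<le> r" using r by blast
    define c where "c = A #> inv g"
    have c: "c \<in> rcosets A" unfolding c_def
      by (rule rcosetsI[OF subgroup.subset[OF assms(1)]]) (use g in simp)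
    have "inv g \<in> c" unfolding c_def using rcos_self[OF _ assms(1)] g by simp
    then obtain a where a: "a \<in> A" "inv g = a \<otimes> b c" using b[OF c] by (auto simp: r_coset_def)
    have aG: "a \<in> carrier G" using subgroup.mem_carrier[OF assms(1) a(1)] .
    have "dist x (\<phi> (inv g) y) \<le> r"
      using act_dist[of "inv g" "\<phi> g x" y] act_inv[OF g(1), of x] g by simp
    moreover have "dist (\<phi> (inv g) y) (\<phi> a y) = dist (\<phi> (b c) y) y"
      using a(2) aG b[OF c] by (simp add: act_mult act_dist)
    moreover have "\<dots> \<le> M" unfolding M_def using assms(2) c by (intro Max_ge) auto
    ultimately have "dist x (\<phi> a y) \<le> r + M"
      using dist_triangle[of x "\<phi> a y" "\<phi> (inv g) y"] by linarith
    with a show ?thesis by blast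
  qed
  then show ?thesis by blast
qed

theorem proposition8:
  fixes G :: "('g, 'm) monoid_scheme"
    and A :: "'g set"
    and n :: nat
    and \<phi> :: "'g \<Rightarrow> 'a \<Rightarrow> 'a::metric_space"
    and \<sigma> :: "'a \<Rightarrow> 'a \<Rightarrow> real \<Rightarrow> 'a"
    and p :: 'a
  assumes "group G"
    and "subgroup A G"
    and "G\<lparr>carrier := A\<rparr> \<cong> product_group {..<n} (\<lambda>_. integer_group)"
    and "\<forall>(x::'a) r. compact (cball x r)"
    and "geometric_action G \<phi>"
    and "bicombing \<sigma>"
    and "consistent \<sigma>"
    and "conical \<sigma>"
    and "reversible \<sigma>"
    and "equivariant G \<phi> \<sigma>"
  shows "(\<exists>S. S \<subseteq> boundary \<sigma> \<and>
            subtopology (boundary_topology \<sigma> p) S homeomorphic_space unit_sphere n) \<and>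
         (finite (rcosets\<^bsub>G\<^esub> A) \<longrightarrow> boundary_topology \<sigma> p homeomorphic_space unit_sphere n)"
proof -
  interpret group G by fact
  interpret equivariant_geometric_action G \<phi> \<sigma>
    by unfold_locales (use assms in auto)
  obtain \<alpha> :: "(nat \<Rightarrow> int) \<Rightarrow> 'g" where
    \<alpha>_add: "\<And>k l. \<alpha> (\<lambda>i. k i + l i) = \<alpha> k \<otimes>\<^bsub>G\<^esub> \<alpha> l" and range_\<alpha>: "range \<alpha> = A"
    and "countable A" and \<alpha>_eq: "\<And>k l. \<alpha> k = \<alpha> l \<longleftrightarrow> (\<forall>i<n. k i = l i)"
    using integer_coordinates[OF assms(1-3)] by blast
  have AG: "A \<subseteq> carrier G" using assms(2) by (rule subgroup.subset)
  have \<alpha>G: "\<alpha> k \<in> carrier G" for k using AG range_\<alpha> by blast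
  have comm: "\<alpha> k \<otimes>\<^bsub>G\<^esub> \<alpha> l = \<alpha> l \<otimes>\<^bsub>G\<^esub> \<alpha> k" for k l
    by (simp add: add.commute flip: \<alpha>_add)
  let ?E = "(\<lambda>j. \<alpha> (\<lambda>i. of_bool (i = j))) ` {..<n}"
  obtain y where y: "\<And>a. a \<in> A \<Longrightarrow> displ a y = transl_len a"
  proof (rule exists_minimal_displacement[OF AG \<open>countable A\<close>])
    show "A \<noteq> {}" using range_\<alpha> by blast
    show "a \<otimes>\<^bsub>G\<^esub> b = b \<otimes>\<^bsub>G\<^esub> a" if "a \<in> A" "b \<in> A" for a b
      using that comm unfolding range_\<alpha>[symmetric] by auto
    show "finite ?E" "?E \<subseteq> A" using range_\<alpha> by auto
    show "h \<otimes>\<^bsub>G\<^esub> a = a \<otimes>\<^bsub>G\<^esub> h"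
      if h: "h \<in> carrier G" "\<And>b. b \<in> ?E \<Longrightarrow> h \<otimes>\<^bsub>G\<^esub> b = b \<otimes>\<^bsub>G\<^esub> h" and a: "a \<in> A" for h a
    proof -
      obtain k where "a = \<alpha> k" using a range_\<alpha> by blast
      moreover have "h \<otimes>\<^bsub>G\<^esub> \<alpha> k = \<alpha> k \<otimes>\<^bsub>G\<^esub> h"
      proof (rule commutes_integer_coordinates[where n = n, OF \<alpha>G \<alpha>_add _ h(1)])
        show "\<alpha> k = \<alpha> l" if "\<forall>i<n. k i = l i" for k l using \<alpha>_eq that by blast
        show "h \<otimes>\<^bsub>G\<^esub> \<alpha> (\<lambda>i. of_bool (i = j)) = \<alpha> (\<lambda>i. of_bool (i = j)) \<otimes>\<^bsub>G\<^esub> h"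
          if "j < n" for j
          using h(2)[OF imageI, of j] that by simp
      qed
      ultimately show ?thesis by simp
    qed
  qed blast
  define q where "q = (\<lambda>k. displ (\<alpha> k) y)"
  define Y where "Y = (\<lambda>k. \<phi> (\<alpha> k) y)"
  have dist_Y: "dist (Y k) (Y l) = q (\<lambda>i. k i - l i)" for k l
  proof -
    have "\<alpha> k = \<alpha> l \<otimes>\<^bsub>G\<^esub> \<alpha> (\<lambda>i. k i - l i)" by (simp flip: \<alpha>_add)
    then show ?thesis by (simp add: Y_def q_def displ_def act_mult act_dist \<alpha>G dist_commute)
  qed
  interpret normed_orbit n q \<sigma> Y p
  proof unfold_locales
    fix k l :: "nat \<Rightarrow> int"
    show "q k = q l" if "\<And>i. i < n \<Longrightarrow> k i = l i"
    proof -
      have "\<alpha> k = \<alpha> l" using that \<alpha>_eq by blast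
      then show ?thesis by (simp add: q_def)
    qed
    show "q (\<lambda>i. k i + l i) \<le> q k + q l" by (simp add: q_def \<alpha>_add displ_mult_le \<alpha>G)
    show "q (\<lambda>i. - k i) = q k"
      using dist_Y[of "\<lambda>i. 0" k] dist_Y[of k "\<lambda>i. 0"] by (simp add: dist_commute)
    \<comment> \<open>Here the minimality of \<open>y\<close> enters: on \<open>A\<close> the
      displacement at \<open>y\<close> is the translation length, which doubles under
      squaring.\<close>
    have "\<alpha> (\<lambda>i. 2 * k i) = \<alpha> k \<otimes>\<^bsub>G\<^esub> \<alpha> k" by (simp flip: \<alpha>_add)
    then show "q (\<lambda>i. 2 * k i) = 2 * q k"
      using y range_\<alpha> transl_len_square[OF \<alpha>G] by (metis q_def rangeI)
  next
    fix C
    have "inj_on \<alpha> {k. (\<forall>i\<ge>n. k i = 0) \<and> q k \<le> C}"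
    proof (rule inj_onI)
      fix k l assume k: "k \<in> {k. (\<forall>i\<ge>n. k i = 0) \<and> q k \<le> C}"
        and l: "l \<in> {k. (\<forall>i\<ge>n. k i = 0) \<and> q k \<le> C}" and "\<alpha> k = \<alpha> l"
      then have "k i = l i" for i using \<alpha>_eq by (cases "i < n") auto
      then show "k = l" by (rule ext)
    qed
    moreover have "\<alpha> ` {k. (\<forall>i\<ge>n. k i = 0) \<and> q k \<le> C} \<subseteq> {g \<in> carrier G. dist y (\<phi> g y) \<le> C}"
      using \<alpha>G by (auto simp: q_def displ_def)
    ultimately show "finite {k. (\<forall>i\<ge>n. k i = 0) \<and> q k \<le> C}"
      using finite_return_set by (rule inj_on_finite)
  qed (use assms dist_Y in auto)
  show ?thesis
  proof (intro conjI impI)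
    show "\<exists>S\<subseteq>boundary \<sigma>. subtopology (boundary_topology \<sigma> p) S homeomorphic_space unit_sphere n"
      by (rule boundary_contains_sphere)
    assume "finite (rcosets\<^bsub>G\<^esub> A)"
    then obtain D where D: "\<And>x. \<exists>a\<in>A. dist x (\<phi> a y) \<le> D"
      using cobounded_finite_index[OF assms(2)] by blast
    have "\<exists>k. dist x (Y k) \<le> D" for x
      using D[of x] unfolding range_\<alpha>[symmetric] Y_def by blast
    then show "boundary_topology \<sigma> p homeomorphic_space unit_sphere n"
      by (rule boundary_homeomorphic_sphere)
  qed
qed

end
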